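(* Let $G$ be a simple matroid on the ground set $[n]=\{1,\ldots,n\}$, let $w_2=\dim\mathcal{A}^2(G)$, and let $\phi_3$ be the nullity (dimension of the kernel) of the multiplication map $d:\mathcal{E}^1\otimes\mathcal{I}^2\to\mathcal{E}^3$, $x\otimes y\mapsto x\wedge y$. Then $$\phi_3=2\binom{n+1}{3}-n\,w_2+\dim\mathcal{A}_2^3.$$
   Context: Let $\mathcal{E}=\Lambda(e_1,\ldots,e_n)$ be the graded exterior algebra over $\mathbb{C}$ with generators $e_i$ of degree one. For an ordered tuple $S=(i_1,\ldots,i_p)$ write $e_S=e_{i_1}\wedge\cdots\wedge e_{i_p}$ and define $\partial:\mathcal{E}^p\to\mathcal{E}^{p-1}$ by $\partial(e_{i_1}\wedge\cdots\wedge e_{i_p})=\sum_{k=1}^p(-1)^{k-1}e_{i_1}\wedge\cdots\wedge\widehat{e_{i_k}}\wedge\cdots\wedge e_{i_p}$. Let $\mathcal{I}$ be the homogeneous ideal of $\mathcal{E}$ generated by $\{\partial e_S : S\text{ dependent in }G\}$, with degree-$p$ part $\mathcal{I}^p$, and let $\mathcal{A}(G)=\mathcal{E}/\mathcal{I}$ be the Orlik-Solomon algebra with degree-$p$ part $\mathcal{A}^p(G)$. The quadratic closure $\mathcal{A}_2=\mathcal{E}/\mathcal{I}_2$, where $\mathcal{I}_2$ is the ideal of $\mathcal{E}$ generated by $\mathcal{I}^1+\mathcal{I}^2$; $\mathcal{A}_2^3$ denotes its degree-three part. *)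

theory Defs
  imports Complex_Main "HOL-Algebra.QuotRing" "Jordan_Normal_Form.VS_Connect"
begin

section \<open>Simple matroids\<close>

locale matroid =
  fixes E :: "'a set" and indep :: "'a set \<Rightarrow> bool"
  assumes finite_ground: "finite E"
    and indep_ground: "indep S \<Longrightarrow> S \<subseteq> E"
    and indep_empty: "indep {}"
    and indep_subset: "indep S \<Longrightarrow> T \<subseteq> S \<Longrightarrow> indep T"
    and augment: "indep S \<Longrightarrow> indep T \<Longrightarrow> card S < card T \<Longrightarrow> \<exists>x\<in>T - S. indep (insert x S)"

locale simple_matroid = matroid +
  assumes no_loop: "x \<in> E \<Longrightarrow> indep {x}"
    and no_parallel: "x \<in> E \<Longrightarrow> y \<in> E \<Longrightarrow> x \<noteq> y \<Longrightarrow> indep {x, y}"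


section \<open>The exterior algebra on \<open>n\<close> generators\<close>

text \<open>An element is the family of its coordinates in the basis of the increasing monomials
  \<open>e\<^sub>S\<close> for \<open>S \<subseteq> {1..n}\<close>.  For disjoint \<open>S\<close> and \<open>T\<close> the product of \<open>e\<^sub>S\<close> and \<open>e\<^sub>T\<close> is
  \<open>e\<^bsub>S \<union> T\<^esub>\<close> times the sign of the permutation sorting \<open>S\<close> followed by \<open>T\<close>; otherwise it is \<open>0\<close>.\<close>

type_synonym ext = "nat set \<Rightarrow> complex"

definition shuffle_sign :: "nat set \<Rightarrow> nat set \<Rightarrow> complex" where
  "shuffle_sign S T = (- 1) ^ card {(s, t). s \<in> S \<and> t \<in> T \<and> t < s}"

definition wedge :: "ext \<Rightarrow> ext \<Rightarrow> ext" where
  "wedge x y = (\<lambda>U. \<Sum>S\<in>Pow U. shuffle_sign S (U - S) * x S * y (U - S))"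

definition ext_alg :: "nat \<Rightarrow> (complex, ext) module" where
  "ext_alg n =
    \<lparr> carrier = {x. \<forall>S. x S \<noteq> 0 \<longrightarrow> S \<subseteq> {1..n}},
      mult = wedge,
      one = (\<lambda>S. if S = {} then 1 else 0),
      zero = (\<lambda>S. 0),
      add = (\<lambda>x y S. x S + y S),
      smult = (\<lambda>c x S. c * x S) \<rparr>"

definition ext_deg :: "nat \<Rightarrow> nat \<Rightarrow> ext set" where
  "ext_deg n p = {x \<in> carrier (ext_alg n). \<forall>S. x S \<noteq> 0 \<longrightarrow> card S = p}"

definition ext_gen :: "nat \<Rightarrow> ext" where
  "ext_gen i = (\<lambda>S. if S = {i} then 1 else 0)"

definition ext_monom :: "nat list \<Rightarrow> ext" where
  "ext_monom is = foldr (\<lambda>i x. wedge (ext_gen i) x) is (\<lambda>S. if S = {} then 1 else 0)"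

definition omit :: "nat \<Rightarrow> 'a list \<Rightarrow> 'a list" where
  "omit k xs = take k xs @ drop (Suc k) xs"

text \<open>The linear map given by the deletion formula on the basis of increasing monomials;
  lists are indexed from \<open>0\<close>, which accounts for the exponent \<open>k\<close> of the sign.  By \<open>ext_bdry_monom\<close> below the
  formula then holds for arbitrary tuples.\<close>

definition ext_bdry :: "nat \<Rightarrow> ext \<Rightarrow> ext" where
  "ext_bdry n x = (\<lambda>U. \<Sum>S\<in>Pow {1..n}.
     x S * (\<Sum>k<card S. (- 1) ^ k * ext_monom (omit k (sorted_list_of_set S)) U))"


section \<open>Orlik-Solomon algebra and quadratic closure\<close>

text \<open>A tuple with a repeated entry has \<open>e\<^sub>S = 0\<close>, so it does not matter for the ideal whether
  such tuples are admitted here.\<close>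

definition os_ideal :: "nat \<Rightarrow> (nat set \<Rightarrow> bool) \<Rightarrow> ext set" where
  "os_ideal n indep =
    Idl\<^bsub>ext_alg n\<^esub> {ext_bdry n (ext_monom is) | is. set is \<subseteq> {1..n} \<and> \<not> indep (set is)}"

definition os_ideal_deg :: "nat \<Rightarrow> (nat set \<Rightarrow> bool) \<Rightarrow> nat \<Rightarrow> ext set" where
  "os_ideal_deg n indep p = os_ideal n indep \<inter> ext_deg n p"

definition os_ideal2 :: "nat \<Rightarrow> (nat set \<Rightarrow> bool) \<Rightarrow> ext set" where
  "os_ideal2 n indep =
    Idl\<^bsub>ext_alg n\<^esub> (os_ideal_deg n indep 1 <+>\<^bsub>ext_alg n\<^esub> os_ideal_deg n indep 2)"

text \<open>\<^const>\<open>FactRing\<close> together with the induced scalar multiplication.\<close>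

definition quot_alg :: "('a, 'b) module \<Rightarrow> 'b set \<Rightarrow> ('a, 'b set) module" where
  "quot_alg M I =
    \<lparr> carrier = carrier (M Quot I),
      mult = mult (M Quot I),
      one = one (M Quot I),
      zero = zero (M Quot I),
      add = add (M Quot I),
      smult = (\<lambda>c X. \<Union>x\<in>X. I +>\<^bsub>M\<^esub> (c \<odot>\<^bsub>M\<^esub> x)) \<rparr>"

definition os_alg :: "nat \<Rightarrow> (nat set \<Rightarrow> bool) \<Rightarrow> (complex, ext set) module" where
  "os_alg n indep = quot_alg (ext_alg n) (os_ideal n indep)"

definition os_alg_deg :: "nat \<Rightarrow> (nat set \<Rightarrow> bool) \<Rightarrow> nat \<Rightarrow> (complex, ext set) module" where
  "os_alg_deg n indep p =
    (os_alg n indep)\<lparr>carrier := (\<lambda>x. os_ideal n indep +>\<^bsub>ext_alg n\<^esub> x) ` ext_deg n p\<rparr>"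

definition os_alg2 :: "nat \<Rightarrow> (nat set \<Rightarrow> bool) \<Rightarrow> (complex, ext set) module" where
  "os_alg2 n indep = quot_alg (ext_alg n) (os_ideal2 n indep)"

definition os_alg2_deg :: "nat \<Rightarrow> (nat set \<Rightarrow> bool) \<Rightarrow> nat \<Rightarrow> (complex, ext set) module" where
  "os_alg2_deg n indep p =
    (os_alg2 n indep)\<lparr>carrier := (\<lambda>x. os_ideal2 n indep +>\<^bsub>ext_alg n\<^esub> x) ` ext_deg n p\<rparr>"


section \<open>Tensor products, the multiplication map and its nullity\<close>

abbreviation cdim :: "(complex, 'a) module \<Rightarrow> nat" where
  "cdim V \<equiv> vectorspace.dim (class_ring :: complex ring) V"

definition fun_space :: "(complex, 'a \<Rightarrow> complex) module" where
  "fun_space =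
    \<lparr> carrier = UNIV,
      mult = (\<lambda>f g a. f a * g a),
      one = (\<lambda>a. 1),
      zero = (\<lambda>a. 0),
      add = (\<lambda>f g a. f a + g a),
      smult = (\<lambda>c f a. c * f a) \<rparr>"

text \<open>The tensor product of two spaces of functions \<open>U \<subseteq> \<complex>\<^sup>A\<close> and \<open>V \<subseteq> \<complex>\<^sup>B\<close>, realised
  as the span of the functions \<open>(a, b) \<mapsto> x a * y b\<close> in \<open>\<complex>\<^bsup>A \<times> B\<^esup>\<close>; it has the universal
  property by \<open>tensor_universal\<close> below.\<close>

definition tensor_pure :: "('a \<Rightarrow> complex) \<Rightarrow> ('b \<Rightarrow> complex) \<Rightarrow> 'a \<times> 'b \<Rightarrow> complex" where
  "tensor_pure x y = (\<lambda>(a, b). x a * y b)"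

definition tensor ::
  "('a \<Rightarrow> complex) set \<Rightarrow> ('b \<Rightarrow> complex) set \<Rightarrow> (complex, 'a \<times> 'b \<Rightarrow> complex) module" where
  "tensor U V = fun_space\<lparr>carrier :=
     LinearCombinations.module.span (class_ring :: complex ring) fun_space {tensor_pure x y | x y. x \<in> U \<and> y \<in> V}\<rparr>"

text \<open>The linear map with \<open>x \<otimes> y \<mapsto> x \<and> y\<close>, see \<open>mult_map_pure\<close>.\<close>

definition mult_map :: "(nat set \<times> nat set \<Rightarrow> complex) \<Rightarrow> ext" where
  "mult_map F = (\<lambda>U. \<Sum>S\<in>Pow U. shuffle_sign S (U - S) * F (S, U - S))"

lemma mult_map_pure: "mult_map (tensor_pure x y) = wedge x y"
  by (simp add: mult_map_def wedge_def tensor_pure_def mult.assoc)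

definition nullity ::
  "(complex, 'a) module \<Rightarrow> (complex, 'b) module \<Rightarrow> ('a \<Rightarrow> 'b) \<Rightarrow> nat" where
  "nullity M N f = cdim (M\<lparr>carrier := mod_hom.ker M N f\<rparr>)"


section \<open>Basic properties of the exterior algebra and its boundary map\<close>

lemma shuffle_sign_empty [simp]: "shuffle_sign S {} = 1" "shuffle_sign {} T = 1"
  by (simp_all add: shuffle_sign_def)

lemma shuffle_sign_Un_left:
  assumes "finite R" "finite T" "finite W" "R \<inter> T = {}"
  shows "shuffle_sign (R \<union> T) W = shuffle_sign R W * shuffle_sign T W"
proof -
  let ?P = "\<lambda>S. {(s, t). s \<in> S \<and> t \<in> W \<and> t < s}"
  have "?P (R \<union> T) = ?P R \<union> ?P T" "?P R \<inter> ?P T = {}" using assms(4) by auto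
  moreover have "finite (?P S)" if "finite S" for S
    by (rule finite_subset[of _ "S \<times> W"]) (use that assms(3) in auto)
  ultimately show ?thesis
    using assms by (simp add: shuffle_sign_def card_Un_disjoint power_add)
qed

lemma shuffle_sign_Un_right:
  assumes "finite R" "finite T" "finite W" "T \<inter> W = {}"
  shows "shuffle_sign R (T \<union> W) = shuffle_sign R T * shuffle_sign R W"
proof -
  let ?P = "\<lambda>S. {(s, t). s \<in> R \<and> t \<in> S \<and> t < s}"
  have "?P (T \<union> W) = ?P T \<union> ?P W" "?P T \<inter> ?P W = {}" using assms(4) by auto
  moreover have "finite (?P S)" if "finite S" for S
    by (rule finite_subset[of _ "R \<times> S"]) (use that assms(1) in auto)
  ultimately show ?thesis
    using assms by (simp add: shuffle_sign_def card_Un_disjoint power_add)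
qed

lemma wedge_infinite: "infinite U \<Longrightarrow> wedge x y U = 0"
  by (simp add: wedge_def)

lemma wedge_assoc: "wedge (wedge x y) z = wedge x (wedge y z)"
proof
  fix U :: "nat set"
  show "wedge (wedge x y) z U = wedge x (wedge y z) U"
  proof (cases "finite U")
    case fin: True
    have fU: "finite S" if "S \<subseteq> U" for S using that fin finite_subset by blast
    have "wedge (wedge x y) z U = (\<Sum>S\<in>Pow U. \<Sum>R\<in>Pow S.
        shuffle_sign S (U - S) * shuffle_sign R (S - R) * x R * y (S - R) * z (U - S))"
      unfolding wedge_def sum_distrib_left sum_distrib_right
      by (simp add: mult_ac)
    also have "\<dots> = (\<Sum>(S, R)\<in>(SIGMA S:Pow U. Pow S).
        shuffle_sign S (U - S) * shuffle_sign R (S - R) * x R * y (S - R) * z (U - S))"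
      by (rule sum.Sigma) (use fU in auto)
    also have "\<dots> = (\<Sum>(R, T)\<in>(SIGMA R:Pow U. Pow (U - R)).
        shuffle_sign R (U - R) * shuffle_sign T (U - R - T) * x R * y T * z (U - R - T))"
    proof (rule sum.reindex_bij_witness[where i = "\<lambda>(R, T). (R \<union> T, R)" and j = "\<lambda>(S, R). (R, S - R)"])
      fix p assume "p \<in> (SIGMA S:Pow U. Pow S)"
      then obtain S R where p: "p = (S, R)" "S \<subseteq> U" "R \<subseteq> S" by auto
      define T W where "T = S - R" and "W = U - S"
      have e: "S = R \<union> T" "U - R = T \<union> W" "U - R - T = W" "S - R = T" "U - S = W"
        using p by (auto simp: T_def W_def)
      have d: "R \<inter> T = {}" "T \<inter> W = {}" "finite R" "finite T" "finite W"
        using p fU fin by (auto simp: T_def W_def)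
      have "shuffle_sign S W * shuffle_sign R T = shuffle_sign R (T \<union> W) * shuffle_sign T W"
        unfolding e(1) using d by (simp add: shuffle_sign_Un_left shuffle_sign_Un_right)
      then show "(case case p of (S, R) \<Rightarrow> (R, S - R) of (R, T) \<Rightarrow>
          shuffle_sign R (U - R) * shuffle_sign T (U - R - T) * x R * y T * z (U - R - T)) =
        (case p of (S, R) \<Rightarrow>
          shuffle_sign S (U - S) * shuffle_sign R (S - R) * x R * y (S - R) * z (U - S))"
        using e by (simp add: p)
    qed auto
    also have "\<dots> = (\<Sum>R\<in>Pow U. \<Sum>T\<in>Pow (U - R).
        shuffle_sign R (U - R) * shuffle_sign T (U - R - T) * x R * y T * z (U - R - T))"
      by (rule sum.Sigma[symmetric]) (use fU fin in auto)
    also have "\<dots> = wedge x (wedge y z) U"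
      unfolding wedge_def sum_distrib_left sum_distrib_right
      by (simp add: mult_ac)
    finally show ?thesis .
  qed (simp add: wedge_infinite)
qed

lemma wedge_closed:
  assumes "x \<in> carrier (ext_alg n)" "y \<in> carrier (ext_alg n)"
  shows "wedge x y \<in> carrier (ext_alg n)"
proof -
  have "U \<subseteq> {1..n}" if "wedge x y U \<noteq> 0" for U
  proof -
    obtain S where "S \<subseteq> U" "x S \<noteq> 0" "y (U - S) \<noteq> 0"
      using \<open>wedge x y U \<noteq> 0\<close> unfolding wedge_def
      by (metis (no_types, lifting) PowD mult_eq_0_iff sum.neutral)
    then show ?thesis using assms unfolding ext_alg_def
      by simp blast
  qed
  then show ?thesis by (simp add: ext_alg_def)
qed

lemma ext_finite_support:
  "x \<in> carrier (ext_alg n) \<Longrightarrow> infinite S \<Longrightarrow> x S = 0"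
  unfolding ext_alg_def using finite_subset by fastforce

lemma ext_alg_ring: "ring (ext_alg n)"
proof (rule ringI)
  show "abelian_group (ext_alg n)"
  proof (rule abelian_groupI)
    fix x assume "x \<in> carrier (ext_alg n)"
    then show "\<exists>y\<in>carrier (ext_alg n). y \<oplus>\<^bsub>ext_alg n\<^esub> x = \<zero>\<^bsub>ext_alg n\<^esub>"
      by (intro bexI[of _ "\<lambda>S. - x S"]) (auto simp: ext_alg_def)
  next
    fix x y assume "x \<in> carrier (ext_alg n)" "y \<in> carrier (ext_alg n)"
    then show "x \<oplus>\<^bsub>ext_alg n\<^esub> y \<in> carrier (ext_alg n)"
      unfolding ext_alg_def by simp (metis add_0)
  qed (auto simp: ext_alg_def add_ac)
  show "Group.monoid (ext_alg n)"
  proof (rule monoidI)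
    fix x assume x: "x \<in> carrier (ext_alg n)"
    show "\<one>\<^bsub>ext_alg n\<^esub> \<otimes>\<^bsub>ext_alg n\<^esub> x = x"
    proof
      fix U show "(\<one>\<^bsub>ext_alg n\<^esub> \<otimes>\<^bsub>ext_alg n\<^esub> x) U = x U"
      proof (cases "finite U")
        case True
        have "(\<Sum>S\<in>Pow U. shuffle_sign S (U - S) * (if S = {} then 1 else 0) * x (U - S)) =
            (\<Sum>S\<in>Pow U. if S = {} then x U else 0)"
          by (rule sum.cong) auto
        then show ?thesis using True by (simp add: ext_alg_def wedge_def)
      qed (use ext_finite_support[OF x] in \<open>simp add: ext_alg_def wedge_infinite\<close>)
    qed
    show "x \<otimes>\<^bsub>ext_alg n\<^esub> \<one>\<^bsub>ext_alg n\<^esub> = x"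
    proof
      fix U show "(x \<otimes>\<^bsub>ext_alg n\<^esub> \<one>\<^bsub>ext_alg n\<^esub>) U = x U"
      proof (cases "finite U")
        case True
        have "(\<Sum>S\<in>Pow U. shuffle_sign S (U - S) * x S * (if U - S = {} then 1 else 0)) =
            (\<Sum>S\<in>Pow U. if S = U then x U else 0)"
          by (rule sum.cong) auto
        then show ?thesis using True by (simp add: ext_alg_def wedge_def)
      qed (use ext_finite_support[OF x] in \<open>simp add: ext_alg_def wedge_infinite\<close>)
    qed
  next
    fix x y assume "x \<in> carrier (ext_alg n)" "y \<in> carrier (ext_alg n)"
    from wedge_closed[OF this] show "x \<otimes>\<^bsub>ext_alg n\<^esub> y \<in> carrier (ext_alg n)"
      by (simp add: ext_alg_def)
  qed (auto simp: ext_alg_def wedge_assoc)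
qed (auto simp: ext_alg_def wedge_def algebra_simps sum.distrib)

lemma ext_alg_vectorspace: "vectorspace class_ring (ext_alg n)"
proof -
  interpret ring "ext_alg n" by (rule ext_alg_ring)
  have "module class_ring (ext_alg n)"
  proof (rule moduleI)
    show "cring (class_ring :: complex ring)" by (rule class_cring.is_cring)
    show "abelian_group (ext_alg n)" by (rule is_abelian_group)
  qed (auto simp: ext_alg_def algebra_simps)
  then show ?thesis
    by (simp add: vectorspace_def class_field.field_axioms)
qed

lemma ext_gen_apply: "ext_gen i S = (if S = {i} then 1 else 0)"
  by (simp add: ext_gen_def)

lemma wedge_ext_gen:
  "wedge (ext_gen i) y U =
    (if finite U \<and> i \<in> U then (- 1) ^ card {j \<in> U. j < i} * y (U - {i}) else 0)"
proof (cases "finite U")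
  case True
  have "wedge (ext_gen i) y U =
      (\<Sum>S\<in>Pow U. if S = {i} then shuffle_sign {i} (U - {i}) * y (U - {i}) else 0)"
    unfolding wedge_def ext_gen_def by (rule sum.cong) auto
  also have "\<dots> = (if i \<in> U then shuffle_sign {i} (U - {i}) * y (U - {i}) else 0)"
    using True by simp
  also have "shuffle_sign {i} (U - {i}) = (- 1) ^ card {j \<in> U. j < i}"
  proof -
    have "{(s, t). s \<in> {i} \<and> t \<in> U - {i} \<and> t < s} = Pair i ` {j \<in> U. j < i}" by auto
    then show ?thesis by (simp add: shuffle_sign_def card_image inj_on_def)
  qed
  finally show ?thesis using True by simp
qed (simp add: wedge_infinite)

lemma wedge_ext_gen_square: "wedge (ext_gen i) (ext_gen i) = (\<lambda>S. 0)"
proof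
  fix S
  have "S - {i} \<noteq> {i}" by blast
  then have "ext_gen i (S - {i}) = 0" by (simp add: ext_gen_def)
  then show "wedge (ext_gen i) (ext_gen i) S = 0" by (simp add: wedge_ext_gen)
qed

lemma wedge_ext_gen_anticommute:
  "wedge (ext_gen i) (ext_gen j) = (\<lambda>S. - wedge (ext_gen j) (ext_gen i) S)"
proof (cases "i = j")
  case False
  show ?thesis
  proof
    fix U
    show "wedge (ext_gen i) (ext_gen j) U = - wedge (ext_gen j) (ext_gen i) U"
    proof (cases "U = {i, j}")
      case True
      have "{k \<in> U. k < i} = (if j < i then {j} else {})" "{k \<in> U. k < j} = (if i < j then {i} else {})"
        "U - {i} = {j}" "U - {j} = {i}" "finite U" "i \<in> U" "j \<in> U"
        using True False by auto
      then show ?thesis using False by (simp add: wedge_ext_gen ext_gen_apply)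
    next
      case F: False
      have "i \<in> U \<Longrightarrow> U - {i} \<noteq> {j}" "j \<in> U \<Longrightarrow> U - {j} \<noteq> {i}" using F by auto
      then have "i \<in> U \<Longrightarrow> ext_gen j (U - {i}) = 0" "j \<in> U \<Longrightarrow> ext_gen i (U - {j}) = 0"
        by (simp_all add: ext_gen_apply)
      then show ?thesis by (simp add: wedge_ext_gen)
    qed
  qed
qed (simp add: wedge_ext_gen_square)

lemma ext_monom_Cons: "ext_monom (i # is) = wedge (ext_gen i) (ext_monom is)"
  by (simp add: ext_monom_def)

lemma ext_monom_sorted:
  "sorted_wrt (<) is \<Longrightarrow> ext_monom is = (\<lambda>U. if U = set is then 1 else 0)"
proof (induction "is")
  case (Cons i "is")
  show ?case
  proof
    fix U
    have i: "i \<notin> set is" and srt: "sorted_wrt (<) is" using Cons.prems by auto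
    show "ext_monom (i # is) U = (if U = set (i # is) then 1 else 0)"
    proof (cases "U = insert i (set is)")
      case True
      have "{j \<in> U. j < i} = {}" using True Cons.prems by auto
      then have "(- 1 :: complex) ^ card {j \<in> U. j < i} = 1" by (simp only: card.empty power_0)
      moreover have "U - {i} = set is" "finite U" "i \<in> U" using True i by auto
      ultimately have "ext_monom (i # is) U = 1"
        by (simp add: ext_monom_Cons wedge_ext_gen Cons.IH[OF srt])
      then show ?thesis using True by simp
    next
      case False
      then have "i \<in> U \<Longrightarrow> U - {i} \<noteq> set is" by auto
      then show ?thesis
        using False by (simp add: ext_monom_Cons wedge_ext_gen Cons.IH[OF srt])
    qed
  qed
qed (simp add: ext_monom_def)


lemma ext_bdry_coord:
  assumes U: "U \<subseteq> {1..n}"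
  shows "ext_bdry n x U = (\<Sum>i\<in>{1..n} - U. (- 1) ^ card {j \<in> U. j < i} * x (insert i U))"
proof -
  have inner: "(\<Sum>k<card S. (- 1) ^ k * ext_monom (omit k (sorted_list_of_set S)) U) =
      (\<Sum>i\<in>S. (- 1) ^ card {j \<in> S. j < i} * (if U = S - {i} then 1 else 0))"
    if S: "S \<subseteq> {1..n}" for S
  proof -
    define L where "L = sorted_list_of_set S"
    have fin: "finite S" using S finite_subset by blast
    have L: "sorted_wrt (<) L" "distinct L" "set L = S" "length L = card S"
      using fin by (simp_all add: L_def)
    have bij: "bij_betw ((!) L) {..<card S} S"
      by (rule bij_betw_nth) (simp_all add: L)
    have mono: "i < j \<Longrightarrow> j < card S \<Longrightarrow> L ! i < L ! j" for i j
      using L sorted_wrt_nth_less by metis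
    have "(\<Sum>i\<in>S. (- 1) ^ card {j \<in> S. j < i} * (if U = S - {i} then 1 else 0)) =
        (\<Sum>k<card S. (- 1) ^ card {j \<in> S. j < L ! k} * (if U = S - {L ! k} then 1 else 0 :: complex))"
      by (rule sum.reindex_bij_betw[OF bij, symmetric])
    also have "\<dots> = (\<Sum>k<card S. (- 1) ^ k * ext_monom (omit k L) U)"
    proof (rule sum.cong[OF refl])
      fix k assume "k \<in> {..<card S}"
      then have k: "k < length L" by (simp add: L)
      have "{j \<in> S. j < L ! k} = (!) L ` {..<k}"
      proof -
        have "j \<in> (!) L ` {..<k}" if "j \<in> S" "j < L ! k" for j
        proof -
          obtain m where m: "m < card S" "j = L ! m" using \<open>j \<in> S\<close> L by (metis in_set_conv_nth)
          have "m < k" using m mono[of k m] \<open>j < L ! k\<close> by (metis k linorder_neqE_nat order_less_asym order_less_irrefl)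
          then show ?thesis using m by auto
        qed
        then show ?thesis using mono k L by (auto simp: nth_mem)
      qed
      moreover have "inj_on ((!) L) {..<k}" using L(2) k by (simp add: inj_on_nth)
      ultimately have card: "card {j \<in> S. j < L ! k} = k" by (simp add: card_image)
      have dec: "L = take k L @ L ! k # drop (Suc k) L" using k by (rule id_take_nth_drop)
      have "sorted_wrt (<) (take k L @ L ! k # drop (Suc k) L)"
        "distinct (take k L @ L ! k # drop (Suc k) L)"
        "set (take k L @ L ! k # drop (Suc k) L) = S" using L dec by auto
      then have "sorted_wrt (<) (omit k L)" "set (omit k L) = S - {L ! k}"
        by (auto simp: omit_def sorted_wrt_append)
      then show "(- 1) ^ card {j \<in> S. j < L ! k} * (if U = S - {L ! k} then 1 else 0 :: complex) =
          (- 1) ^ k * ext_monom (omit k L) U"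
        by (simp add: card ext_monom_sorted)
    qed
    finally show ?thesis by (simp add: L_def)
  qed
  have fS: "finite S" if "S \<in> Pow {1..n}" for S :: "nat set" using that finite_subset by blast
  let ?A = "SIGMA S:Pow {1..n}. S"
  let ?f = "\<lambda>(S, i). x S * ((- 1) ^ card {j \<in> S. j < i} * (if U = S - {i} then 1 else 0))"
  have "ext_bdry n x U = (\<Sum>S\<in>Pow {1..n}. \<Sum>i\<in>S. ?f (S, i))"
    unfolding ext_bdry_def by (rule sum.cong) (auto simp: inner sum_distrib_left)
  also have "\<dots> = (\<Sum>p\<in>?A. ?f p)"
    using fS by (simp add: sum.Sigma)
  also have "\<dots> = (\<Sum>p\<in>(\<lambda>i. (insert i U, i)) ` ({1..n} - U). ?f p)"
  proof (rule sum.mono_neutral_right)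
    show "finite ?A" using fS by (intro finite_SigmaI) auto
    show "(\<lambda>i. (insert i U, i)) ` ({1..n} - U) \<subseteq> ?A" using U by auto
    show "\<forall>p\<in>?A - (\<lambda>i. (insert i U, i)) ` ({1..n} - U). ?f p = 0"
    proof
      fix p assume p: "p \<in> ?A - (\<lambda>i. (insert i U, i)) ` ({1..n} - U)"
      obtain S i where Si: "p = (S, i)" by (cases p)
      have "U \<noteq> S - {i}"
      proof
        assume "U = S - {i}"
        then have "S = insert i U" "i \<in> {1..n} - U" using p Si by auto
        then show False using p Si by auto
      qed
      then show "?f p = 0" by (simp add: Si)
    qed
  qed
  also have "\<dots> = (\<Sum>i\<in>{1..n} - U. ?f (insert i U, i))"
    by (subst sum.reindex) (auto simp: inj_on_def)
  also have "\<dots> = (\<Sum>i\<in>{1..n} - U. (- 1) ^ card {j \<in> U. j < i} * x (insert i U))"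
  proof (rule sum.cong[OF refl])
    fix i assume "i \<in> {1..n} - U"
    moreover have "{j \<in> insert i U. j < i} = {j \<in> U. j < i}" by auto
    ultimately show "?f (insert i U, i) = (- 1) ^ card {j \<in> U. j < i} * x (insert i U)" by simp
  qed
  finally show ?thesis .
qed

lemma ext_bdry_outside:
  assumes "\<not> U \<subseteq> {1..n}"
  shows "ext_bdry n x U = 0"
proof -
  have "ext_monom (omit k (sorted_list_of_set S)) U = 0" if "S \<in> Pow {1..n}" for S k
  proof -
    let ?L = "sorted_list_of_set S"
    have fin: "finite S" using that finite_subset by blast
    have "sorted_wrt (<) (take k ?L @ drop k ?L)" using fin by simp
    moreover have "sorted_wrt (<) (drop (Suc k) ?L)" using fin by simp
    moreover have "set (drop (Suc k) ?L) \<subseteq> set (drop k ?L)" by (simp add: set_drop_subset_set_drop)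
    ultimately have "sorted_wrt (<) (omit k ?L)"
      unfolding omit_def sorted_wrt_append by blast
    moreover have "set (omit k ?L) \<subseteq> {1..n}"
      using fin that set_take_subset[of k ?L] set_drop_subset[of "Suc k" ?L]
      unfolding omit_def by auto
    ultimately show ?thesis using assms by (auto simp: ext_monom_sorted)
  qed
  then show ?thesis unfolding ext_bdry_def by (intro sum.neutral ballI) simp
qed

lemma card_less_insert:
  assumes "finite U" "i \<notin> U"
  shows "(- 1) ^ card {j \<in> insert i U. j < m} =
    (if i < m then - 1 else 1 :: complex) * (- 1) ^ card {j \<in> U. j < m}"
proof -
  have "{j \<in> insert i U. j < m} = (if i < m then insert i {j \<in> U. j < m} else {j \<in> U. j < m})"
    by auto
  then show ?thesis using assms by simp
qed

lemma ext_bdry_wedge_gen: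
  assumes i: "i \<in> {1..n}" and y: "y \<in> carrier (ext_alg n)"
  shows "ext_bdry n (wedge (ext_gen i) y) = (\<lambda>U. y U - wedge (ext_gen i) (ext_bdry n y) U)"
proof
  fix U
  let ?c = "\<lambda>m U. (- 1 :: complex) ^ card {j \<in> U. j < m}"
  have sq: "?c m V * ?c m V = 1" for m V by (simp flip: power_mult_distrib)
  show "ext_bdry n (wedge (ext_gen i) y) U = y U - wedge (ext_gen i) (ext_bdry n y) U"
  proof (cases "U \<subseteq> {1..n}")
    case out: False
    then have "y U = 0" "\<not> U - {i} \<subseteq> {1..n}" using y i by (auto simp: ext_alg_def)
    then show ?thesis using out by (simp add: ext_bdry_outside wedge_ext_gen)
  next
    case U: True
    then have fin: "finite U" using finite_subset by blast
    show ?thesis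
    proof (cases "i \<in> U")
      case False
      have "ext_bdry n (wedge (ext_gen i) y) U =
          (\<Sum>m\<in>{1..n} - U. if m = i then ?c i U * ?c i (insert i U) * y U else 0)"
        unfolding ext_bdry_coord[OF U]
        by (rule sum.cong) (use False fin in \<open>auto simp: wedge_ext_gen\<close>)
      also have "\<dots> = y U" using i False card_less_insert[OF fin False, of i] by (simp add: sq)
      finally show ?thesis using False by (simp add: wedge_ext_gen)
    next
      case True
      define V where "V = U - {i}"
      have V: "U = insert i V" "i \<notin> V" "finite V" "V \<subseteq> {1..n}"
        using True U fin by (auto simp: V_def)
      have c1: "?c i U = ?c i V" using card_less_insert[OF V(3,2), of i] V(1) by simp
      have A: "ext_bdry n (wedge (ext_gen i) y) U =
          (\<Sum>m\<in>{1..n} - U. - (?c i V * ?c m V * y (insert m V)))"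
        unfolding ext_bdry_coord[OF U]
      proof (rule sum.cong[OF refl])
        fix m assume m: "m \<in> {1..n} - U"
        have "insert m U - {i} = insert m V" using m V by auto
        moreover have "?c i (insert m U) = (if m < i then - 1 else 1) * ?c i V"
          using card_less_insert[OF fin, of m i] m c1 by simp
        moreover have "?c m U = (if i < m then - 1 else 1) * ?c m V"
          using card_less_insert[OF V(3,2), of m] V(1) by simp
        moreover have "m \<noteq> i" using m True by auto
        ultimately show "?c m U * wedge (ext_gen i) y (insert m U) =
            - (?c i V * ?c m V * y (insert m V))"
          using True fin by (cases "m < i") (auto simp: wedge_ext_gen)
      qed
      have "wedge (ext_gen i) (ext_bdry n y) U =
          ?c i V * (\<Sum>m\<in>insert i ({1..n} - U). ?c m V * y (insert m V))"
      proof -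
        have "insert i ({1..n} - U) = {1..n} - V" using V i by auto
        then show ?thesis using True fin V(4) c1
          by (simp add: wedge_ext_gen ext_bdry_coord flip: V_def)
      qed
      also have "\<dots> = y U + (\<Sum>m\<in>{1..n} - U. ?c i V * ?c m V * y (insert m V))"
        using True sq[of V i] V(1)
        by (simp add: sum_distrib_left distrib_left mult.assoc[symmetric])
      finally show ?thesis using A by (simp add: sum_negf)
    qed
  qed
qed

lemma ext_gen_carrier: "i \<in> {1..n} \<Longrightarrow> ext_gen i \<in> carrier (ext_alg n)"
  by (simp add: ext_gen_def ext_alg_def)

lemma ext_monom_carrier: "set is \<subseteq> {1..n} \<Longrightarrow> ext_monom is \<in> carrier (ext_alg n)"
proof (induction "is")
  case Nil
  show ?case by (simp add: ext_monom_def ext_alg_def)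
next
  case (Cons i "is")
  then show ?case by (simp add: ext_monom_Cons wedge_closed ext_gen_carrier)
qed

theorem ext_bdry_monom:
  assumes "set is \<subseteq> {1..n}"
  shows "ext_bdry n (ext_monom is) = (\<lambda>U. \<Sum>k<length is. (- 1) ^ k * ext_monom (omit k is) U)"
  using assms
proof (induction "is")
  case Nil
  have "ext_bdry n (ext_monom []) U = 0" for U
  proof (cases "U \<subseteq> {1..n}")
    case True
    show ?thesis unfolding ext_bdry_coord[OF True]
      by (rule sum.neutral) (simp add: ext_monom_def)
  qed (rule ext_bdry_outside)
  then show ?case by auto
next
  case (Cons i "is")
  have i: "i \<in> {1..n}" and s: "set is \<subseteq> {1..n}" using Cons.prems by auto
  show ?case
  proof
    fix U
    have "wedge (ext_gen i) (ext_bdry n (ext_monom is)) U =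
        (\<Sum>k<length is. (- 1) ^ k * ext_monom (i # omit k is) U)"
      unfolding Cons.IH[OF s] ext_monom_Cons
      by (auto simp: wedge_ext_gen sum_distrib_left mult_ac)
    then have "ext_bdry n (ext_monom (i # is)) U =
        ext_monom is U - (\<Sum>k<length is. (- 1) ^ k * ext_monom (i # omit k is) U)"
      unfolding ext_monom_Cons[of i "is"] ext_bdry_wedge_gen[OF i ext_monom_carrier[OF s]] by simp
    also have "\<dots> = (\<Sum>k<length (i # is). (- 1) ^ k * ext_monom (omit k (i # is)) U)"
      by (simp add: sum.lessThan_Suc_shift omit_def sum_negf del: sum.lessThan_Suc)
    finally show "ext_bdry n (ext_monom (i # is)) U =
        (\<Sum>k<length (i # is). (- 1) ^ k * ext_monom (omit k (i # is)) U)" .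
  qed
qed


section \<open>Universal property of the tensor product\<close>

lemma fun_space_vectorspace: "vectorspace class_ring fun_space"
proof -
  have "module class_ring (fun_space :: (complex, 'a \<Rightarrow> complex) module)"
  proof (rule moduleI)
    show "cring (class_ring :: complex ring)" by (rule class_cring.is_cring)
    show "abelian_group (fun_space :: (complex, 'a \<Rightarrow> complex) module)"
    proof (rule abelian_groupI)
      fix x :: "'a \<Rightarrow> complex"
      show "\<exists>y\<in>carrier fun_space. y \<oplus>\<^bsub>fun_space\<^esub> x = \<zero>\<^bsub>fun_space\<^esub>"
        by (intro bexI[of _ "\<lambda>a. - x a"]) (auto simp: fun_space_def)
    qed (auto simp: fun_space_def add_ac)
  qed (auto simp: fun_space_def algebra_simps)
  then show ?thesis by (simp add: vectorspace_def class_field.field_axioms)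
qed

fun bsum :: "('c, 'w, 'm) module_scheme \<Rightarrow> ('a \<Rightarrow> 'b \<Rightarrow> 'w) \<Rightarrow> ('a \<times> 'b) list \<Rightarrow> 'w" where
  "bsum W b [] = \<zero>\<^bsub>W\<^esub>"
| "bsum W b ((x, y) # ps) = b x y \<oplus>\<^bsub>W\<^esub> bsum W b ps"

locale bilinear_on =
  W: vectorspace "class_ring :: complex ring" W for W :: "(complex, 'w, 'm) module_scheme" +
  fixes U :: "('a \<Rightarrow> complex) set" and V :: "('b \<Rightarrow> complex) set"
    and b :: "('a \<Rightarrow> complex) \<Rightarrow> ('b \<Rightarrow> complex) \<Rightarrow> 'w"
  assumes U: "subspace class_ring U fun_space" and V: "subspace class_ring V fun_space"
    and closed [simp]: "x \<in> U \<Longrightarrow> y \<in> V \<Longrightarrow> b x y \<in> carrier W"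
    and add_left: "x \<in> U \<Longrightarrow> x' \<in> U \<Longrightarrow> y \<in> V \<Longrightarrow> b (\<lambda>a. x a + x' a) y = b x y \<oplus>\<^bsub>W\<^esub> b x' y"
    and add_right: "x \<in> U \<Longrightarrow> y \<in> V \<Longrightarrow> y' \<in> V \<Longrightarrow> b x (\<lambda>a. y a + y' a) = b x y \<oplus>\<^bsub>W\<^esub> b x y'"
    and scale_left: "x \<in> U \<Longrightarrow> y \<in> V \<Longrightarrow> b (\<lambda>a. c * x a) y = c \<odot>\<^bsub>W\<^esub> b x y"
    and scale_right: "x \<in> U \<Longrightarrow> y \<in> V \<Longrightarrow> b x (\<lambda>a. c * y a) = c \<odot>\<^bsub>W\<^esub> b x y"
begin

lemma U_zero [simp]: "(\<lambda>a. 0) \<in> U"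
  and U_add [simp]: "x \<in> U \<Longrightarrow> x' \<in> U \<Longrightarrow> (\<lambda>a. x a + x' a) \<in> U"
  and U_scale [simp]: "x \<in> U \<Longrightarrow> (\<lambda>a. c * x a) \<in> U"
proof -
  interpret submodule class_ring U fun_space using U by (simp add: VectorSpace.subspace_def)
  show "(\<lambda>a. 0) \<in> U" using zero_closed by (simp add: fun_space_def)
  show "x \<in> U \<Longrightarrow> x' \<in> U \<Longrightarrow> (\<lambda>a. x a + x' a) \<in> U" using m_closed[of x x'] by (simp add: fun_space_def)
  show "x \<in> U \<Longrightarrow> (\<lambda>a. c * x a) \<in> U" using smult_closed[of c x] by (simp add: fun_space_def)
qed

lemma V_zero [simp]: "(\<lambda>a. 0) \<in> V"
  and V_add [simp]: "y \<in> V \<Longrightarrow> y' \<in> V \<Longrightarrow> (\<lambda>a. y a + y' a) \<in> V"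
  and V_scale [simp]: "y \<in> V \<Longrightarrow> (\<lambda>a. c * y a) \<in> V"
proof -
  interpret submodule class_ring V fun_space using V by (simp add: VectorSpace.subspace_def)
  show "(\<lambda>a. 0) \<in> V" using zero_closed by (simp add: fun_space_def)
  show "y \<in> V \<Longrightarrow> y' \<in> V \<Longrightarrow> (\<lambda>a. y a + y' a) \<in> V" using m_closed[of y y'] by (simp add: fun_space_def)
  show "y \<in> V \<Longrightarrow> (\<lambda>a. c * y a) \<in> V" using smult_closed[of c y] by (simp add: fun_space_def)
qed

lemma zero_left: "y \<in> V \<Longrightarrow> b (\<lambda>a. 0) y = \<zero>\<^bsub>W\<^esub>"
  using scale_left[of "\<lambda>a. 0" y 0] W.smult_l_null[of "b (\<lambda>a. 0) y"] by simp

lemma zero_right: "x \<in> U \<Longrightarrow> b x (\<lambda>a. 0) = \<zero>\<^bsub>W\<^esub>"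
  using scale_right[of x "\<lambda>a. 0" 0] W.smult_l_null[of "b x (\<lambda>a. 0)"] by simp

lemma bsum_closed [simp]: "set ps \<subseteq> U \<times> V \<Longrightarrow> bsum W b ps \<in> carrier W"
  by (induction ps) auto

lemma bsum_append:
  "set ps \<subseteq> U \<times> V \<Longrightarrow> set qs \<subseteq> U \<times> V \<Longrightarrow> bsum W b (ps @ qs) = bsum W b ps \<oplus>\<^bsub>W\<^esub> bsum W b qs"
  by (induction ps) (auto simp: W.a_assoc)

lemma bsum_scale:
  "set ps \<subseteq> U \<times> V \<Longrightarrow>
    bsum W b (map (\<lambda>(x, y). (\<lambda>a. c * x a, y)) ps) = c \<odot>\<^bsub>W\<^esub> bsum W b ps"
  by (induction ps) (auto simp: W.smult_r_distr scale_left)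

lemma bsum_shift:
  assumes "x0 \<in> U" "set ps \<subseteq> U \<times> V"
  shows "(\<lambda>a. \<Sum>(x, y)\<leftarrow>ps. c x * y a) \<in> V"
    and "bsum W b (map (\<lambda>(x, y). (\<lambda>a. x a + c x * x0 a, y)) ps) =
      bsum W b ps \<oplus>\<^bsub>W\<^esub> b x0 (\<lambda>a. \<Sum>(x, y)\<leftarrow>ps. c x * y a)"
  using assms(2)
proof (induction ps)
  case Nil
  { case 1 show ?case by simp }
  { case 2 show ?case using assms(1) by (simp add: zero_right) }
next
  case (Cons p ps)
  obtain x y where p: "p = (x, y)" by (cases p)
  let ?s = "\<lambda>a. \<Sum>(x, y)\<leftarrow>ps. c x * y a"
  { case 1 then show ?case using Cons.IH(1) p by simp }
  { case 2
    then have xy: "x \<in> U" "y \<in> V" "set ps \<subseteq> U \<times> V" using p by auto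
    note s = Cons.IH(1)[OF xy(3)]
    have "b (\<lambda>a. x a + c x * x0 a) y = b x y \<oplus>\<^bsub>W\<^esub> b x0 (\<lambda>a. c x * y a)"
      using xy assms(1) by (simp add: add_left scale_left scale_right)
    moreover have "b x0 (\<lambda>a. c x * y a + ?s a) = b x0 (\<lambda>a. c x * y a) \<oplus>\<^bsub>W\<^esub> b x0 ?s"
      using xy s assms(1) by (simp add: add_right)
    ultimately show ?case
      using xy s assms(1) Cons.IH(2)[OF xy(3)]
      by (simp add: p W.a_ac) }
qed

end

lemma bsum_pure: "bsum fun_space tensor_pure ps = (\<lambda>(a, b). \<Sum>(x, y)\<leftarrow>ps. x a * y b)"
  by (induction ps) (auto simp: fun_space_def tensor_pure_def fun_eq_iff)

lemma (in bilinear_on) bsum_eq_zero: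
  assumes "set ps \<subseteq> U \<times> V" "\<And>a d. (\<Sum>(x, y)\<leftarrow>ps. x a * y d) = 0"
  shows "bsum W b ps = \<zero>\<^bsub>W\<^esub>"
  using assms
proof (induction "length ps" arbitrary: ps)
  case (Suc k)
  obtain x0 y0 qs where ps: "ps = (x0, y0) # qs"
    using Suc.hyps(2) by (cases ps) auto
  have in_sp: "x0 \<in> U" "y0 \<in> V" "set qs \<subseteq> U \<times> V" and k: "k = length qs"
    using Suc.prems(1) Suc.hyps(2) ps by auto
  have eq: "x0 a * y0 d + (\<Sum>(x, y)\<leftarrow>qs. x a * y d) = 0" for a d
    using Suc.prems(2)[of a d] ps by simp
  show ?case
  proof (cases "x0 = (\<lambda>a. 0)")
    case True
    then have "bsum W b qs = \<zero>\<^bsub>W\<^esub>" using Suc.hyps(1)[OF k in_sp(3)] eq by simp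
    then show ?thesis using True in_sp by (simp add: ps zero_left)
  next
    case False
    then obtain a0 where a0: "x0 a0 \<noteq> 0" by auto
    define c where "c = (\<lambda>x. - (x a0 / x0 a0))"
    let ?s = "\<lambda>d. \<Sum>(x, y)\<leftarrow>qs. c x * y d"
    let ?qs = "map (\<lambda>(x, y). (\<lambda>a. x a + c x * x0 a, y)) qs"
    have sum: "?s d = - ((\<Sum>(x, y)\<leftarrow>qs. x a0 * y d) / x0 a0)" for d
      by (induction qs) (auto simp: c_def add_divide_distrib)
    have s: "?s = y0"
    proof
      fix d
      have "(\<Sum>(x, y)\<leftarrow>qs. x a0 * y d) = - (x0 a0 * y0 d)"
        using eq[of a0 d] by (simp add: eq_neg_iff_add_eq_0 add.commute)
      then show "?s d = y0 d" using a0 by (simp add: sum)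
    qed
    have "set ?qs \<subseteq> U \<times> V" using in_sp by auto
    moreover have "(\<Sum>(x, y)\<leftarrow>?qs. x a * y d) = (\<Sum>(x, y)\<leftarrow>qs. x a * y d) + x0 a * ?s d" for a d
      by (induction qs) (auto simp: algebra_simps)
    then have "(\<Sum>(x, y)\<leftarrow>?qs. x a * y d) = 0" for a d
      using eq[of a d] s by (simp add: fun_eq_iff add.commute)
    ultimately have "bsum W b ?qs = \<zero>\<^bsub>W\<^esub>" using Suc.hyps(1)[of ?qs] k by simp
    then show ?thesis
      using bsum_shift(2)[OF in_sp(1,3), of c] s in_sp by (simp add: ps W.a_comm)
  qed
qed simp

lemma bilinear_on_tensor_pure:
  assumes "subspace class_ring U fun_space" "subspace class_ring V fun_space"
  shows "bilinear_on fun_space U V tensor_pure"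
  by (intro bilinear_on.intro fun_space_vectorspace bilinear_on_axioms.intro assms)
    (auto simp: fun_space_def tensor_pure_def fun_eq_iff algebra_simps)

lemma tensor_carrier:
  "carrier (tensor U V) = {bsum fun_space tensor_pure ps | ps. set ps \<subseteq> U \<times> V}" (is "_ = ?N")
  if U: "subspace class_ring U fun_space" and V: "subspace class_ring V fun_space"
proof -
  interpret F: vectorspace "class_ring :: complex ring"
    "fun_space :: (complex, 'a \<times> 'b \<Rightarrow> complex) module" by (rule fun_space_vectorspace)
  interpret bilinear_on fun_space U V tensor_pure
    by (rule bilinear_on_tensor_pure[OF U V])
  let ?P = "{tensor_pure x y | x y. x \<in> U \<and> y \<in> V}"
  have P: "?P \<subseteq> carrier fun_space" by (simp add: fun_space_def)
  have N: "submodule class_ring ?N fun_space"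
  proof
    fix v w assume "v \<in> ?N" "w \<in> ?N"
    then obtain ps qs where "set ps \<subseteq> U \<times> V" "set qs \<subseteq> U \<times> V"
      "v = bsum fun_space tensor_pure ps" "w = bsum fun_space tensor_pure qs" by blast
    then show "v \<oplus>\<^bsub>fun_space\<^esub> w \<in> ?N" using bsum_append[of ps qs]
      by (metis (mono_tags, lifting) Un_least mem_Collect_eq set_append)
  next
    show "\<zero>\<^bsub>fun_space\<^esub> \<in> ?N" by (auto intro!: exI[of _ "[]"])
  next
    fix c v assume "v \<in> ?N"
    then obtain ps where ps: "set ps \<subseteq> U \<times> V" "v = bsum fun_space tensor_pure ps" by blast
    let ?qs = "map (\<lambda>(x, y). (\<lambda>a. c * x a, y)) ps"
    have "set ?qs \<subseteq> U \<times> V" using ps by auto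
    then show "c \<odot>\<^bsub>fun_space\<^esub> v \<in> ?N" using bsum_scale[OF ps(1), of c] ps(2)
      by (metis (mono_tags, lifting) mem_Collect_eq)
  qed (auto simp: fun_space_def)
  have "F.span ?P \<subseteq> ?N"
  proof (rule F.span_is_subset[OF _ N])
    show "?P \<subseteq> ?N"
    proof
      fix t assume "t \<in> ?P"
      then obtain x y where "x \<in> U" "y \<in> V" "t = tensor_pure x y" by auto
      then show "t \<in> ?N" by (intro CollectI exI[of _ "[(x, y)]"]) (simp add: fun_space_def)
    qed
  qed
  moreover have "?N \<subseteq> F.span ?P"
  proof
    fix t assume "t \<in> ?N"
    then obtain ps where "set ps \<subseteq> U \<times> V" "t = bsum fun_space tensor_pure ps" by blast
    then show "t \<in> F.span ?P"
    proof (induction ps arbitrary: t)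
      case Nil
      show ?case using Nil submodule.zero_closed[OF F.span_is_submodule[OF P]] by simp
    next
      case (Cons p ps)
      obtain x y where p: "p = (x, y)" by (cases p)
      have "tensor_pure x y \<in> F.span ?P"
        using F.in_own_span[OF P] Cons.prems p by auto
      moreover have "bsum fun_space tensor_pure ps \<in> F.span ?P"
        using Cons by simp
      ultimately show ?case
        using submodule.m_closed[OF F.span_is_submodule[OF P]] Cons.prems p by simp
    qed
  qed
  ultimately show ?thesis by (auto simp: tensor_def)
qed

theorem (in bilinear_on) tensor_universal:
  shows "\<exists>f \<in> LinearCombinations.module_hom class_ring (tensor U V) W. \<forall>x\<in>U. \<forall>y\<in>V. f (tensor_pure x y) = b x y"
    and "f \<in> LinearCombinations.module_hom class_ring (tensor U V) W \<Longrightarrow> g \<in> LinearCombinations.module_hom class_ring (tensor U V) W \<Longrightarrow>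
      \<forall>x\<in>U. \<forall>y\<in>V. f (tensor_pure x y) = b x y \<Longrightarrow> \<forall>x\<in>U. \<forall>y\<in>V. g (tensor_pure x y) = b x y \<Longrightarrow>
      t \<in> carrier (tensor U V) \<Longrightarrow> f t = g t"
proof -
  interpret P: bilinear_on fun_space U V tensor_pure
    by (rule bilinear_on_tensor_pure[OF U V])
  let ?B = "bsum fun_space tensor_pure :: _ \<Rightarrow> 'a \<times> 'b \<Rightarrow> complex"
  note car = tensor_carrier[OF U V]
  have T: "add (tensor U V) = add fun_space" "smult (tensor U V) = smult fun_space"
    by (simp_all add: tensor_def)
  have neg: "\<ominus>\<^bsub>W\<^esub> w = (- 1) \<odot>\<^bsub>W\<^esub> w" if "w \<in> carrier W" for w
    using W.smult_minus_1[OF that] by (simp add: class_ring_simps)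
  have wd: "bsum W b ps = bsum W b qs"
    if "set ps \<subseteq> U \<times> V" "set qs \<subseteq> U \<times> V" "?B ps = ?B qs" for ps qs
  proof -
    let ?qs = "map (\<lambda>(x, y). (\<lambda>a. - 1 * x a, y)) qs"
    have qs: "set ?qs \<subseteq> U \<times> V" using that(2) U_scale[of _ "- 1"] by fastforce
    have "?B (ps @ ?qs) = ?B ps \<oplus>\<^bsub>fun_space\<^esub> (- 1) \<odot>\<^bsub>fun_space\<^esub> ?B qs"
      using P.bsum_append[OF that(1) qs] P.bsum_scale[OF that(2), of "- 1"] by simp
    also have "\<dots> = (\<lambda>_. 0)" unfolding that(3) by (simp add: fun_space_def)
    finally have B0: "?B (ps @ ?qs) = (\<lambda>_. 0)" .
    have "(\<Sum>(x, y)\<leftarrow>ps @ ?qs. x a * y d) = 0" for a d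
      using fun_cong[OF B0, of "(a, d)"] unfolding bsum_pure by (simp only: prod.case)
    then have "bsum W b (ps @ ?qs) = \<zero>\<^bsub>W\<^esub>"
      using that(1) qs by (intro bsum_eq_zero) simp_all
    then have "bsum W b ps \<oplus>\<^bsub>W\<^esub> \<ominus>\<^bsub>W\<^esub> bsum W b qs = \<zero>\<^bsub>W\<^esub>"
      using bsum_append[OF that(1) qs] bsum_scale[OF that(2), of "- 1"] neg that(2) by simp
    then show ?thesis
      using that by (metis W.minus_equality W.minus_minus bsum_closed W.a_inv_closed)
  qed
  define F where "F = (\<lambda>t. bsum W b (SOME ps. set ps \<subseteq> U \<times> V \<and> ?B ps = t))"
  have F: "F (?B ps) = bsum W b ps" if "set ps \<subseteq> U \<times> V" for ps
  proof -
    have "set (SOME qs. set qs \<subseteq> U \<times> V \<and> ?B qs = ?B ps) \<subseteq> U \<times> V \<and>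
        ?B (SOME qs. set qs \<subseteq> U \<times> V \<and> ?B qs = ?B ps) = ?B ps"
      by (rule someI[of _ ps]) (use that in simp)
    then show ?thesis unfolding F_def using wd that by blast
  qed
  have "F \<in> LinearCombinations.module_hom class_ring (tensor U V) W"
  proof -
    have "F (?B ps \<oplus>\<^bsub>fun_space\<^esub> ?B qs) = F (?B ps) \<oplus>\<^bsub>W\<^esub> F (?B qs)"
      if "set ps \<subseteq> U \<times> V" "set qs \<subseteq> U \<times> V" for ps qs
      using that F[of "ps @ qs"] F[of ps] F[of qs]
      by (simp add: bsum_append P.bsum_append)
    moreover have "F (c \<odot>\<^bsub>fun_space\<^esub> ?B ps) = c \<odot>\<^bsub>W\<^esub> F (?B ps)"
      if "set ps \<subseteq> U \<times> V" for c ps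
    proof -
      let ?ps = "map (\<lambda>(x, y). (\<lambda>a. c * x a, y)) ps"
      have "set ?ps \<subseteq> U \<times> V" using that by auto
      from F[OF this] F[OF that] show ?thesis
        using bsum_scale[OF that, of c] P.bsum_scale[OF that, of c] by simp
    qed
    moreover have "F (?B ps) \<in> carrier W" if "set ps \<subseteq> U \<times> V" for ps
      using F[OF that] that by simp
    ultimately show ?thesis unfolding LinearCombinations.module_hom_def T car by auto
  qed
  moreover have "F (tensor_pure x y) = b x y" if "x \<in> U" "y \<in> V" for x y
    using F[of "[(x, y)]"] that by (simp add: fun_space_def)
  ultimately show "\<exists>f \<in> LinearCombinations.module_hom class_ring (tensor U V) W. \<forall>x\<in>U. \<forall>y\<in>V. f (tensor_pure x y) = b x y"
    by blast
next
  assume fg: "f \<in> LinearCombinations.module_hom class_ring (tensor U V) W" "g \<in> LinearCombinations.module_hom class_ring (tensor U V) W"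
    "\<forall>x\<in>U. \<forall>y\<in>V. f (tensor_pure x y) = b x y" "\<forall>x\<in>U. \<forall>y\<in>V. g (tensor_pure x y) = b x y"
    and t: "t \<in> carrier (tensor U V)"
  let ?B = "bsum fun_space tensor_pure :: _ \<Rightarrow> 'a \<times> 'b \<Rightarrow> complex"
  note car = tensor_carrier[OF U V]
  have T: "add (tensor U V) = add fun_space" "smult (tensor U V) = smult fun_space"
    by (simp_all add: tensor_def)
  have h: "h (?B ps) = bsum W b ps" if h: "h \<in> LinearCombinations.module_hom class_ring (tensor U V) W"
    "\<forall>x\<in>U. \<forall>y\<in>V. h (tensor_pure x y) = b x y" and ps: "set ps \<subseteq> U \<times> V" for h ps
    using ps
  proof (induction ps)
    case Nil
    have 0: "\<zero>\<^bsub>fun_space\<^esub> \<in> carrier (tensor U V)"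
      unfolding car by (auto intro!: exI[of _ "[]"])
    have z: "0 \<odot>\<^bsub>fun_space\<^esub> \<zero>\<^bsub>fun_space\<^esub> = (\<zero>\<^bsub>fun_space\<^esub> :: 'a \<times> 'b \<Rightarrow> complex)"
      by (simp add: fun_space_def)
    have "h (0 \<odot>\<^bsub>fun_space\<^esub> \<zero>\<^bsub>fun_space\<^esub>) = 0 \<odot>\<^bsub>W\<^esub> h \<zero>\<^bsub>fun_space\<^esub>"
      using h(1) 0 unfolding LinearCombinations.module_hom_def T by simp
    then have "h \<zero>\<^bsub>fun_space\<^esub> = 0 \<odot>\<^bsub>W\<^esub> h \<zero>\<^bsub>fun_space\<^esub>"
      unfolding z .
    moreover have "h \<zero>\<^bsub>fun_space\<^esub> \<in> carrier W"
      using h(1) 0 unfolding LinearCombinations.module_hom_def by auto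
    ultimately show ?case using W.smult_l_null by simp
  next
    case (Cons p ps)
    obtain x y where p: "p = (x, y)" by (cases p)
    have "set [(x, y)] \<subseteq> U \<times> V" "set ps \<subseteq> U \<times> V" using Cons.prems p by auto
    then have "?B [(x, y)] \<in> carrier (tensor U V)" "?B ps \<in> carrier (tensor U V)"
      unfolding car by blast+
    moreover have "?B [(x, y)] = tensor_pure x y" by (simp add: fun_space_def)
    ultimately have "h (tensor_pure x y \<oplus>\<^bsub>fun_space\<^esub> ?B ps) = h (tensor_pure x y) \<oplus>\<^bsub>W\<^esub> h (?B ps)"
      using h(1) unfolding LinearCombinations.module_hom_def T by simp
    then show ?case using Cons p h(2) by simp
  qed
  obtain ps where "set ps \<subseteq> U \<times> V" "t = ?B ps" using t unfolding car by blast
  then show "f t = g t" using h[OF fg(1,3)] h[OF fg(2,4)] by simp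
qed

end

theory Submission
  imports Defs
begin

text \<open>Since \<open>G\<close> is simple, \<open>\<I>\<close> starts in degree two, so \<open>\<I>\<^sub>2\<close> is generated by \<open>\<I>\<^sup>2\<close> and its degree-three part is
  exactly the image of the multiplication map \<open>d\<close>.  Rank-nullity for \<open>d\<close> and for the two quotient maps onto
  \<open>\<A>\<^sup>2\<close> and \<open>\<A>\<^sub>2\<^sup>3\<close> gives \<open>\<phi>\<^sub>3 = n ((n choose 2) - w\<^sub>2) - (n choose 3) + dim \<A>\<^sub>2\<^sup>3\<close>.\<close>

section \<open>Dimension counts in spaces of functions\<close>

text \<open>The obstacle is that \<open>Idl\<close> presents \<open>os_ideal2\<close> only as the
  least two-sided ideal over its generators; it gives no form for its elements, hence no direct
  access to their degree-three components. So the generated ideal is bounded from outside: for a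
  subspace \<open>W\<close> containing all products of \<open>ext_deg n 1\<close> with
  \<open>\<I>\<^sup>2\<close>, an explicit ideal over the generators is built whose elements have
  their degree-three component in \<open>W\<close>. Minimality does the rest, with the image of
  \<open>d\<close> as \<open>W\<close>. Signs are handled for products from the left only; an
  anti-automorphism covers the other side. Dimensions are compared in spaces of functions with
  finitely many coordinates, where tensoring with \<open>ext_deg n 1\<close> means choosing one
  vector of \<open>\<I>\<^sup>2\<close> per generator; this is the origin of the factor
  \<open>n\<close>. The term with \<open>Suc n choose 3\<close> comes from rewriting
  \<open>n * (n choose 2) - (n choose 3)\<close>.\<close>

lemma linear_map_onto:
  assumes V: "vectorspace K V" and onto: "f ` carrier V = carrier W"
    and add: "\<And>x y. x \<in> carrier V \<Longrightarrow> y \<in> carrier V \<Longrightarrow> f (x \<oplus>\<^bsub>V\<^esub> y) = f x \<oplus>\<^bsub>W\<^esub> f y"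
    and smult: "\<And>c x. c \<in> carrier K \<Longrightarrow> x \<in> carrier V \<Longrightarrow> f (c \<odot>\<^bsub>V\<^esub> x) = c \<odot>\<^bsub>W\<^esub> f x"
    and zero: "f \<zero>\<^bsub>V\<^esub> = \<zero>\<^bsub>W\<^esub>"
  shows "linear_map K V W f"
proof -
  interpret V: vectorspace K V by fact
  have "field K" by unfold_locales
  moreover have "f x \<in> carrier W" if "x \<in> carrier V" for x using onto that by blast
  \<comment> \<open>\<open>W\<close> may be a quotient or have a changed carrier, where no axiom is
    at hand; each one is carried over from \<open>V\<close> along the surjection
    \<open>f\<close>.\<close>
  moreover have "vectorspace K W"
  proof (rule vs_criteria)
    show "\<zero>\<^bsub>W\<^esub> \<in> carrier W" using onto zero V.zero_closed by (metis imageI)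
    show "\<forall>v w. v \<in> carrier W \<and> w \<in> carrier W \<longrightarrow> v \<oplus>\<^bsub>W\<^esub> w \<in> carrier W"
      unfolding onto[symmetric] by (auto simp: add[symmetric])
    show "\<forall>v\<in>carrier W. \<exists>w\<in>carrier W. v \<oplus>\<^bsub>W\<^esub> w = \<zero>\<^bsub>W\<^esub>"
      unfolding onto[symmetric] by (auto simp: add[symmetric] zero[symmetric])
        (metis V.a_inv_closed V.r_neg)
    show "\<forall>c v. c \<in> carrier K \<and> v \<in> carrier W \<longrightarrow> c \<odot>\<^bsub>W\<^esub> v \<in> carrier W"
      unfolding onto[symmetric] by (auto simp: smult[symmetric])
    show "\<forall>v w. v \<in> carrier W \<and> w \<in> carrier W \<longrightarrow> v \<oplus>\<^bsub>W\<^esub> w = w \<oplus>\<^bsub>W\<^esub> v"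
      unfolding onto[symmetric] by (auto simp: add[symmetric] V.a_comm)
    show "\<forall>v w x. v \<in> carrier W \<and> w \<in> carrier W \<and> x \<in> carrier W \<longrightarrow>
        v \<oplus>\<^bsub>W\<^esub> w \<oplus>\<^bsub>W\<^esub> x = v \<oplus>\<^bsub>W\<^esub> (w \<oplus>\<^bsub>W\<^esub> x)"
      unfolding onto[symmetric] by (auto simp: add[symmetric] V.a_assoc)
    show "\<forall>v\<in>carrier W. v \<oplus>\<^bsub>W\<^esub> \<zero>\<^bsub>W\<^esub> = v"
      unfolding onto[symmetric] by (auto simp: add[symmetric] zero[symmetric])
    show "\<forall>c d v. c \<in> carrier K \<and> d \<in> carrier K \<and> v \<in> carrier W \<longrightarrow>
        (c \<oplus>\<^bsub>K\<^esub> d) \<odot>\<^bsub>W\<^esub> v = c \<odot>\<^bsub>W\<^esub> v \<oplus>\<^bsub>W\<^esub> d \<odot>\<^bsub>W\<^esub> v"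
      unfolding onto[symmetric] by (auto simp: add[symmetric] smult[symmetric] V.smult_l_distr)
    show "\<forall>c v w. c \<in> carrier K \<and> v \<in> carrier W \<and> w \<in> carrier W \<longrightarrow>
        c \<odot>\<^bsub>W\<^esub> (v \<oplus>\<^bsub>W\<^esub> w) = c \<odot>\<^bsub>W\<^esub> v \<oplus>\<^bsub>W\<^esub> c \<odot>\<^bsub>W\<^esub> w"
      unfolding onto[symmetric] by (auto simp: add[symmetric] smult[symmetric] V.smult_r_distr)
    show "\<forall>c d v. c \<in> carrier K \<and> d \<in> carrier K \<and> v \<in> carrier W \<longrightarrow>
        (c \<otimes>\<^bsub>K\<^esub> d) \<odot>\<^bsub>W\<^esub> v = c \<odot>\<^bsub>W\<^esub> (d \<odot>\<^bsub>W\<^esub> v)"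
      unfolding onto[symmetric] by (auto simp: smult[symmetric] V.smult_assoc1)
    show "\<forall>v\<in>carrier W. \<one>\<^bsub>K\<^esub> \<odot>\<^bsub>W\<^esub> v = v"
      unfolding onto[symmetric] by (auto simp: smult[symmetric])
  qed fact
  ultimately show ?thesis
    using V add smult
    by (simp add: linear_map_def mod_hom_def mod_hom_axioms_def LinearCombinations.module_hom_def
        vectorspace_def)
qed

lemma (in linear_map) dim_onto:
  assumes "V.fin_dim" "T ` carrier V = carrier W"
  shows "W.dim + vectorspace.dim K (V.vs kerT) = V.dim"
  using rank_nullity[OF assms(1)] assms(2) by (simp add: surj_imp_imT_carrier)

text \<open>Independent sets of the subspace stay independent in \<open>V\<close>, so
  \<open>dim\<close> bounds their size; a maximal one is a finite basis.\<close>

lemma (in vectorspace) subspace_fin_dim: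
  assumes "fin_dim" "subspace K W V"
  shows "vectorspace.fin_dim K (vs W)"
proof -
  interpret W: vectorspace K "vs W" using assms(2) by (rule subspace_is_vs)
  have sub: "submodule K W V" "W \<subseteq> carrier V"
    using assms(2) by (auto simp: subspace_def submodule_def)
  have "\<exists>B. finite B \<and> maximal B (\<lambda>S. S \<subseteq> carrier (vs W) \<and> W.lin_indpt S)"
  proof (rule maximal_exists)
    fix S assume "S \<subseteq> carrier (vs W) \<and> W.lin_indpt S"
    then have "S \<subseteq> carrier V" "lin_indpt S"
      using sub span_li_not_depend(2)[of S W] by auto
    then show "finite S \<and> card S \<le> dim" using li_le_dim[OF assms(1)] by blast
  next
    show "{} \<subseteq> carrier (vs W) \<and> W.lin_indpt {}" by (auto simp: W.lin_dep_def)
  qed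
  then obtain B where "finite B" "W.basis B" using W.max_li_is_basis by blast
  then show ?thesis by (auto simp: W.fin_dim_def W.basis_def)
qed

section \<open>Coordinate spaces and their subspaces\<close>

abbreviation fun_sub :: "('a \<Rightarrow> complex) set \<Rightarrow> (complex, 'a \<Rightarrow> complex) module" where
  "fun_sub U \<equiv> fun_space\<lparr>carrier := U\<rparr>"

lemma fun_subspaceI:
  assumes "(\<lambda>a. 0) \<in> U" "\<And>x y. x \<in> U \<Longrightarrow> y \<in> U \<Longrightarrow> (\<lambda>a. x a + y a) \<in> U"
    "\<And>c x. x \<in> U \<Longrightarrow> (\<lambda>a. c * x a) \<in> U"
  shows "subspace class_ring U fun_space"
proof -
  interpret vectorspace class_ring "fun_space :: (complex, 'a \<Rightarrow> complex) module"
    by (rule fun_space_vectorspace)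
  show ?thesis
    unfolding VectorSpace.subspace_def submodule_def
    using assms vectorspace_axioms module_axioms by (auto simp: fun_space_def)
qed

lemma fun_sub_vectorspace:
  "subspace class_ring U fun_space \<Longrightarrow> vectorspace class_ring (fun_sub U)"
  using vectorspace.subspace_is_vs[OF fun_space_vectorspace] .

definition supported_on :: "'a set \<Rightarrow> ('a \<Rightarrow> complex) set" where
  "supported_on I = {x. \<forall>a. x a \<noteq> 0 \<longrightarrow> a \<in> I}"

lemma subspace_supported_on: "subspace class_ring (supported_on I) fun_space"
  by (rule fun_subspaceI) (auto simp: supported_on_def, force)

lemma supported_on_dim:
  assumes "finite I"
  shows "vectorspace.fin_dim class_ring (fun_sub (supported_on I))"
    and "cdim (fun_sub (supported_on I)) = card I"
proof -
  let ?V = "fun_sub (supported_on I)"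
  \<comment> \<open>The indicator functions of the points of \<open>I\<close>, which will be the
    basis.\<close>
  let ?d = "\<lambda>i a. if a = i then 1 else 0 :: complex"
  interpret V: vectorspace class_ring ?V
    by (rule fun_sub_vectorspace[OF subspace_supported_on])
  have inj: "inj_on ?d I"
  proof (rule inj_onI)
    fix i j assume "?d i = ?d j"
    then have "?d i i = ?d j i" by (rule fun_cong)
    then show "i = j" by (simp split: if_splits)
  qed
  have sub: "?d ` I \<subseteq> carrier ?V" by (auto simp: supported_on_def split: if_splits)
  have lc: "V.lincomb c B = (\<lambda>a. \<Sum>v\<in>B. c v * v a)" if "finite B" "B \<subseteq> carrier ?V" for c B
    using that
  proof (induction B)
    case empty
    show ?case by (simp only: V.lincomb_empty) (simp add: fun_space_def)
  next
    case (insert v B)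
    then have "V.lincomb c (insert v B) = c v \<odot>\<^bsub>?V\<^esub> v \<oplus>\<^bsub>?V\<^esub> V.lincomb c B"
      by (intro V.lincomb_insert2) auto
    then show ?case using insert by (simp add: fun_space_def)
  qed
  have lcd: "V.lincomb c (?d ` I) a = (if a \<in> I then c (?d a) else 0)" for c a
  proof -
    have "V.lincomb c (?d ` I) a = (\<Sum>i\<in>I. c (?d i) * ?d i a)"
      using assms sub by (simp add: lc sum.reindex[OF inj])
    also have "\<dots> = (\<Sum>i\<in>I. if i = a then c (?d a) else 0)" by (rule sum.cong) auto
    finally show ?thesis using assms by simp
  qed
  have "V.lin_indpt (?d ` I)"
  proof (rule V.finite_lin_indpt2)
    fix c assume c: "V.lincomb c (?d ` I) = \<zero>\<^bsub>?V\<^esub>"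
    have "c (?d i) = 0" if "i \<in> I" for i
      using lcd[of c i] that unfolding c by (simp add: fun_space_def)
    then show "\<forall>v\<in>?d ` I. c v = \<zero>\<^bsub>class_ring\<^esub>" by auto
  qed (use assms sub in auto)
  moreover have "V.gen_set (?d ` I)"
  proof
    show "V.span (?d ` I) \<subseteq> carrier ?V" using sub by (rule V.span_is_subset2)
    show "carrier ?V \<subseteq> V.span (?d ` I)"
    proof
      fix x assume x: "x \<in> carrier ?V"
      \<comment> \<open>\<open>lincomb\<close> takes coefficients indexed by vectors, so the
        coordinate \<open>x i\<close> has to be attached to \<open>?d i\<close> through the inverse
        of \<open>?d\<close>.\<close>
      define c where "c = (\<lambda>v. x (the_inv_into I ?d v))"
      have "c (?d i) = x i" if "i \<in> I" for i
        using the_inv_into_f_f[OF inj that] by (simp add: c_def)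
      then have "V.lincomb c (?d ` I) = x"
        using x by (intro ext) (auto simp: lcd, auto simp: supported_on_def)
      then show "x \<in> V.span (?d ` I)"
        using V.finite_span[OF _ sub] assms by auto
    qed
  qed
  ultimately have "V.basis (?d ` I)" using sub by (simp add: V.basis_def)
  then show "V.fin_dim" "V.dim = card I"
    using assms V.dim_basis[of "?d ` I"]
    by (auto simp: V.fin_dim_def V.basis_def card_image[OF inj])
qed

lemma subspace_fun_sub_fin_dim:
  assumes "subspace class_ring U fun_space" "U \<subseteq> supported_on I" "finite I"
  shows "vectorspace.fin_dim class_ring (fun_sub U)"
proof -
  let ?V = "fun_sub (supported_on I)"
  interpret V: vectorspace class_ring ?V
    by (rule fun_sub_vectorspace[OF subspace_supported_on])
  have "subspace class_ring U ?V"
    using assms(1,2) V.module_axioms V.vectorspace_axioms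
    by (simp add: VectorSpace.subspace_def submodule_def)
  from V.subspace_fin_dim[OF supported_on_dim(1)[OF assms(3)] this] show ?thesis by simp
qed

text \<open>A concrete model of the tensor product of \<open>supported_on I\<close> and
  \<open>V\<close> for finite \<open>I\<close>: a matrix whose rows over \<open>I\<close> are
  vectors of \<open>V\<close>.\<close>

definition slices :: "'a set \<Rightarrow> ('b \<Rightarrow> complex) set \<Rightarrow> ('a \<times> 'b \<Rightarrow> complex) set" where
  "slices I V = {F. (\<forall>a\<in>I. (\<lambda>b. F (a, b)) \<in> V) \<and> (\<forall>a b. a \<notin> I \<longrightarrow> F (a, b) = 0)}"

lemma fun_subspaceD:
  assumes "subspace class_ring U fun_space"
  shows "(\<lambda>a. 0) \<in> U" "x \<in> U \<Longrightarrow> y \<in> U \<Longrightarrow> (\<lambda>a. x a + y a) \<in> U"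
    "x \<in> U \<Longrightarrow> (\<lambda>a. c * x a) \<in> U"
proof -
  interpret submodule class_ring U fun_space using assms by (simp add: VectorSpace.subspace_def)
  show "(\<lambda>a. 0) \<in> U" using zero_closed by (simp add: fun_space_def)
  show "x \<in> U \<Longrightarrow> y \<in> U \<Longrightarrow> (\<lambda>a. x a + y a) \<in> U" using m_closed[of x y] by (simp add: fun_space_def)
  show "x \<in> U \<Longrightarrow> (\<lambda>a. c * x a) \<in> U" using smult_closed[of c x] by (simp add: fun_space_def)
qed

lemma subspace_slices:
  assumes "subspace class_ring V fun_space"
  shows "subspace class_ring (slices I V) fun_space"
  using fun_subspaceD[OF assms]
  by (intro fun_subspaceI) (auto simp: slices_def)

lemma slices_supported_on:
  assumes "V \<subseteq> supported_on J"
  shows "slices I V \<subseteq> supported_on (I \<times> J)"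
proof
  fix F assume F: "F \<in> slices I V"
  have "a \<in> I \<and> b \<in> J" if "F (a, b) \<noteq> 0" for a b
  proof -
    have "a \<in> I" "(\<lambda>b. F (a, b)) \<in> V"
      using F that by (auto simp: slices_def)
    then show ?thesis using assms that by (auto simp: supported_on_def)
  qed
  then show "F \<in> supported_on (I \<times> J)" by (auto simp: supported_on_def)
qed

text \<open>By induction on \<open>I\<close>: reading off row \<open>i\<close> is onto
  \<open>V\<close>, and its kernel consists of the slices over the remaining indices. The finite set
  \<open>J\<close> makes the spaces finite-dimensional, as rank-nullity demands.\<close>

lemma cdim_slices:
  fixes I :: "'i set"
  assumes V: "subspace class_ring V fun_space" and VJ: "V \<subseteq> supported_on J" and J: "finite J"
    and I: "finite I"
  shows "cdim (fun_sub (slices I V)) = card I * cdim (fun_sub V)"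
  using I
proof (induction I)
  case empty
  have "slices ({} :: 'i set) V = supported_on {}" by (auto simp: slices_def supported_on_def fun_eq_iff)
  then show ?case by (simp add: supported_on_dim(2))
next
  case (insert i I)
  let ?T = "fun_sub (slices (insert i I) V)" and ?f = "\<lambda>F b. F (i, b)"
  have T: "subspace class_ring (slices (insert i I) V) fun_space" by (rule subspace_slices[OF V])
  have onto: "?f ` carrier ?T = carrier (fun_sub V)"
  proof -
    have "y \<in> ?f ` slices (insert i I) V" if "y \<in> V" for y
    proof (rule image_eqI[where x = "\<lambda>(a, b). if a = i then y b else 0"])
      have "(\<lambda>b. if a = i then y b else 0) \<in> V" for a
        using that fun_subspaceD(1)[OF V] by (cases "a = i") simp_all
      then show "(\<lambda>(a, b). if a = i then y b else 0) \<in> slices (insert i I) V"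
        using that by (auto simp: slices_def)
    qed simp
    then show ?thesis by (auto simp: slices_def)
  qed
  interpret f: linear_map class_ring ?T "fun_sub V" ?f
    by (rule linear_map_onto[OF fun_sub_vectorspace[OF T] onto]) (auto simp: fun_space_def)
  have "f.kerT = slices I V"
    unfolding f.ker_def using insert.hyps(2) fun_subspaceD(1)[OF V]
    by (auto simp: slices_def fun_space_def fun_eq_iff split: if_splits)
  moreover have "f.V.fin_dim"
  proof (rule subspace_fun_sub_fin_dim[OF T])
    show "slices (insert i I) V \<subseteq> supported_on (insert i I \<times> J)"
      by (rule slices_supported_on[OF VJ])
    show "finite (insert i I \<times> J)" using insert.hyps(1) J by simp
  qed
  ultimately show ?case using f.dim_onto[OF _ onto] insert by simp
qed

section \<open>Graded pieces of the exterior algebra and its quotients\<close>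

lemma ext_deg_eq: "ext_deg n p = supported_on {S. S \<subseteq> {1..n} \<and> card S = p}"
  by (auto simp: ext_deg_def ext_alg_def supported_on_def)

lemma finite_subsets_card: "finite {S. S \<subseteq> {1..n :: nat} \<and> card S = p}"
  by (rule finite_subset[of _ "Pow {1..n}"]) auto

lemma subspace_ext_deg: "subspace class_ring (ext_deg n p) fun_space"
  unfolding ext_deg_eq by (rule subspace_supported_on)

lemma cdim_ext_deg: "cdim (fun_sub (ext_deg n p)) = n choose p"
  unfolding ext_deg_eq supported_on_dim(2)[OF finite_subsets_card] by (simp add: n_subsets)

lemma subspace_ext_deg_fin_dim:
  "subspace class_ring U fun_space \<Longrightarrow> U \<subseteq> ext_deg n p \<Longrightarrow> vectorspace.fin_dim class_ring (fun_sub U)"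
  unfolding ext_deg_eq by (rule subspace_fun_sub_fin_dim[OF _ _ finite_subsets_card])

text \<open>Both structures add and scale pointwise, so the identity moves dimension counts between
  them.\<close>

lemma fun_sub_ext_alg:
  assumes U: "subspace class_ring U fun_space"
  shows "linear_map class_ring (fun_sub U) ((ext_alg n)\<lparr>carrier := U\<rparr>) (\<lambda>x. x)"
  by (rule linear_map_onto[OF fun_sub_vectorspace[OF U]]) (auto simp: ext_alg_def fun_space_def)

lemma cdim_ext_sub:
  assumes U: "subspace class_ring U fun_space" and "U \<subseteq> ext_deg n p"
  shows "cdim ((ext_alg n)\<lparr>carrier := U\<rparr>) = cdim (fun_sub U)"
proof -
  interpret linear_map class_ring "fun_sub U" "(ext_alg n)\<lparr>carrier := U\<rparr>" "\<lambda>x. x"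
    by (rule fun_sub_ext_alg[OF U])
  show ?thesis by (rule dim_eq[symmetric, OF subspace_ext_deg_fin_dim[OF assms]]) auto
qed

section \<open>Ideals of the exterior algebra and dimensions of quotients\<close>

lemma wedge_scale_left: "wedge (\<lambda>S. c * x S) y = (\<lambda>U. c * wedge x y U)"
  by (simp add: wedge_def sum_distrib_left mult_ac)

lemma ext_alg_simps:
  "mult (ext_alg n) = wedge" "one (ext_alg n) = (\<lambda>S. if S = {} then 1 else 0)"
  "zero (ext_alg n) = (\<lambda>S. 0)" "add (ext_alg n) = (\<lambda>x y S. x S + y S)"
  "smult (ext_alg n) = (\<lambda>c x S. c * x S)"
  by (simp_all add: ext_alg_def)

text \<open>Closure under additive inverses follows from absorption, as \<open>\<ominus> x\<close>
  is the product of \<open>\<ominus> \<one>\<close> and \<open>x\<close>.\<close>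

lemma (in ring) idealI_closed:
  assumes "I \<subseteq> carrier R" "\<zero> \<in> I" "\<And>x y. x \<in> I \<Longrightarrow> y \<in> I \<Longrightarrow> x \<oplus> y \<in> I"
    and left: "\<And>a x. a \<in> carrier R \<Longrightarrow> x \<in> I \<Longrightarrow> a \<otimes> x \<in> I"
    and right: "\<And>a x. a \<in> carrier R \<Longrightarrow> x \<in> I \<Longrightarrow> x \<otimes> a \<in> I"
  shows "ideal I R"
proof (rule idealI)
  show "subgroup I (add_monoid R)"
  proof
    fix x assume x: "x \<in> I"
    then have "\<ominus> \<one> \<otimes> x = \<ominus> x" using assms(1) by (auto simp: l_minus)
    then have "\<ominus> x \<in> I" using left[OF _ x, of "\<ominus> \<one>"] by simp
    then show "inv\<^bsub>add_monoid R\<^esub> x \<in> I" by (simp add: a_inv_def)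
  qed (use assms in auto)
qed (use assms ring_axioms in auto)

context
  fixes n :: nat and I :: "ext set"
  assumes I: "ideal I (ext_alg n)"
begin

interpretation I: ideal I "ext_alg n" by (rule I)

text \<open>Scaling by \<open>c\<close> is multiplication by the algebra element \<open>c\<close>
  times one, which an ideal absorbs.\<close>

lemma ideal_subspace: "subspace class_ring I fun_space"
proof (rule fun_subspaceI)
  show "(\<lambda>S. 0) \<in> I" using additive_subgroup.zero_closed[OF I.additive_subgroup_axioms] by (simp add: ext_alg_simps)
  show "(\<lambda>S. x S + y S) \<in> I" if "x \<in> I" "y \<in> I" for x y
    using additive_subgroup.a_closed[OF I.additive_subgroup_axioms that] by (simp add: ext_alg_simps)
  fix c x assume x: "x \<in> I"
  have "(\<lambda>S. c * (if S = {} then 1 else 0)) \<in> carrier (ext_alg n)"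
    by (simp add: ext_alg_def)
  from I.I_l_closed[OF x this] have "(\<lambda>U. c * wedge (\<lambda>S. if S = {} then 1 else 0) x U) \<in> I"
    by (simp add: ext_alg_simps wedge_scale_left)
  then show "(\<lambda>S. c * x S) \<in> I"
    using I.l_one[OF I.a_Hcarr[OF x]] by (simp add: ext_alg_simps)
qed

text \<open>The left side is how \<open>quot_alg\<close> defines scaling. Two representatives differ
  by some \<open>i\<close> in \<open>I\<close>, their multiples by \<open>c * i\<close>, again in
  \<open>I\<close>; so the union runs over copies of one coset.\<close>

lemma coset_scale:
  assumes "x \<in> carrier (ext_alg n)"
  shows "(\<Union>y\<in>I +>\<^bsub>ext_alg n\<^esub> x. I +>\<^bsub>ext_alg n\<^esub> (\<lambda>S. c * y S)) = I +>\<^bsub>ext_alg n\<^esub> (\<lambda>S. c * x S)"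
proof -
  have cx: "(\<lambda>S. c * x S) \<in> carrier (ext_alg n)" using assms by (simp add: ext_alg_def)
  have "I +>\<^bsub>ext_alg n\<^esub> (\<lambda>S. c * y S) = I +>\<^bsub>ext_alg n\<^esub> (\<lambda>S. c * x S)"
    if y: "y \<in> I +>\<^bsub>ext_alg n\<^esub> x" for y
  proof -
    obtain i where i: "i \<in> I" "y = (\<lambda>S. i S + x S)"
      using y by (auto simp: a_r_coset_def' ext_alg_simps)
    have "(\<lambda>S. c * y S) \<in> I +>\<^bsub>ext_alg n\<^esub> (\<lambda>S. c * x S)"
      using fun_subspaceD(3)[OF ideal_subspace i(1), of c]
      by (auto simp: a_r_coset_def' ext_alg_simps i(2) distrib_left)
    then show ?thesis using I.a_repr_independence[OF _ cx I.a_subgroup] by simp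
  qed
  moreover have "x \<in> I +>\<^bsub>ext_alg n\<^esub> x" by (rule I.a_rcos_self[OF assms])
  ultimately show ?thesis by blast
qed

text \<open>Rank-nullity for the quotient map on degree \<open>p\<close>, whose kernel is the
  degree-\<open>p\<close> part of \<open>I\<close>.\<close>

lemma cdim_quot_alg:
  "cdim ((quot_alg (ext_alg n) I)\<lparr>carrier := (\<lambda>x. I +>\<^bsub>ext_alg n\<^esub> x) ` ext_deg n p\<rparr>) +
    cdim (fun_sub (I \<inter> ext_deg n p)) = n choose p"
proof -
  let ?W = "(quot_alg (ext_alg n) I)\<lparr>carrier := (\<lambda>x. I +>\<^bsub>ext_alg n\<^esub> x) ` ext_deg n p\<rparr>"
  let ?f = "\<lambda>x. I +>\<^bsub>ext_alg n\<^esub> x"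
  have E: "x \<in> carrier (ext_alg n)" if "x \<in> ext_deg n p" for x
    using that by (simp add: ext_deg_def)
  have zero: "x \<in> I \<longleftrightarrow> ?f x = I" if "x \<in> carrier (ext_alg n)" for x
    using that I.a_rcos_self I.a_coset_join2 I.a_subgroup by blast
  interpret f: linear_map class_ring "fun_sub (ext_deg n p)" ?W ?f
  proof (rule linear_map_onto[OF fun_sub_vectorspace[OF subspace_ext_deg]])
    fix x y assume "x \<in> carrier (fun_sub (ext_deg n p))" "y \<in> carrier (fun_sub (ext_deg n p))"
    then show "?f (x \<oplus>\<^bsub>fun_sub (ext_deg n p)\<^esub> y) = ?f x \<oplus>\<^bsub>?W\<^esub> ?f y"
      using I.a_rcos_sum[OF E E, of x y]
      by (simp add: quot_alg_def FactRing_def fun_space_def ext_alg_simps)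
  next
    fix c x assume "x \<in> carrier (fun_sub (ext_deg n p))"
    then show "?f (c \<odot>\<^bsub>fun_sub (ext_deg n p)\<^esub> x) = c \<odot>\<^bsub>?W\<^esub> ?f x"
      using coset_scale[OF E, of x c] by (simp add: quot_alg_def fun_space_def ext_alg_simps)
  next
    show "?f \<zero>\<^bsub>fun_sub (ext_deg n p)\<^esub> = \<zero>\<^bsub>?W\<^esub>"
      using zero[of "\<lambda>S. 0"] fun_subspaceD(1)[OF ideal_subspace]
      by (simp add: quot_alg_def FactRing_def fun_space_def ext_alg_def)
  qed simp
  have "f.kerT = I \<inter> ext_deg n p"
    unfolding f.ker_def using zero E by (auto simp: quot_alg_def FactRing_def)
  then show ?thesis
    using f.dim_onto[OF subspace_ext_deg_fin_dim[OF subspace_ext_deg subset_refl]] cdim_ext_deg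
    by simp
qed

end

section \<open>Lowest-degree behaviour of the product\<close>

definition ext_proj :: "nat \<Rightarrow> ext \<Rightarrow> ext" where
  "ext_proj p x = (\<lambda>S. if card S = p then x S else 0)"

text \<open>The \<open>p\<close>-th power of the augmentation ideal. Infinite \<open>S\<close> have
  \<open>card S = 0\<close>, but elements of the carrier vanish there anyway.\<close>

definition ext_ge :: "nat \<Rightarrow> nat \<Rightarrow> ext set" where
  "ext_ge n p = {x \<in> carrier (ext_alg n). \<forall>S. card S < p \<longrightarrow> x S = 0}"

lemma ext_proj_deg: "x \<in> carrier (ext_alg n) \<Longrightarrow> ext_proj p x \<in> ext_deg n p"
  by (auto simp: ext_proj_def ext_deg_def ext_alg_def split: if_splits)

text \<open>The anti-automorphism reversing the factors of each monomial; it reduces products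
  from the right to products from the left.\<close>

definition ext_rev :: "ext \<Rightarrow> ext" where
  "ext_rev x = (\<lambda>S. (- 1) ^ (card S choose 2) * x S)"

text \<open>Each pair in \<open>S \<times> T\<close> is an inversion in exactly one of the two
  orders, so the two inversion counts add up to \<open>card S * card T\<close>.\<close>

lemma shuffle_sign_swap:
  assumes "finite S" "finite T" "S \<inter> T = {}"
  shows "shuffle_sign T S = (- 1) ^ (card S * card T) * shuffle_sign S T"
proof -
  let ?A = "{(s, t). s \<in> S \<and> t \<in> T \<and> t < s}"
  let ?B = "{(s, t). s \<in> T \<and> t \<in> S \<and> t < s}"
  have "S \<times> T = ?A \<union> prod.swap ` ?B"
  proof -
    have "(s, t) \<in> ?A \<or> (t, s) \<in> ?B" if "s \<in> S" "t \<in> T" for s t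
      using that assms(3) by (cases s t rule: linorder_cases) auto
    then show ?thesis by (force simp: image_iff)
  qed
  moreover have "?A \<inter> prod.swap ` ?B = {}" by auto
  moreover have "finite ?A" "finite ?B"
    using finite_subset[of ?A "S \<times> T"] finite_subset[of ?B "T \<times> S"] assms by auto
  ultimately have "card (S \<times> T) = card ?A + card (prod.swap ` ?B)"
    by (metis (no_types, lifting) card_Un_disjoint finite_imageI)
  then have "card S * card T = card ?A + card ?B"
    by (simp add: card_image card_cartesian_product)
  then have "(- 1 :: complex) ^ (card S * card T) = shuffle_sign S T * shuffle_sign T S"
    by (simp add: shuffle_sign_def power_add)
  moreover have "shuffle_sign S T * shuffle_sign S T = 1"
    by (simp add: shuffle_sign_def flip: power_add mult_2)
  ultimately show ?thesis by (simp add: mult_ac)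
qed

text \<open>A pair lies in the first block, in the second, or takes one element from each.\<close>

lemma choose_two_add: "(m + k) choose 2 = (m choose 2) + (k choose 2) + m * k"
  by (induction m) (simp_all add: numeral_2_eq_2)

text \<open>Reversing \<open>p\<close> factors takes \<open>p choose 2\<close> transpositions. By
  \<open>choose_two_add\<close> the three reversal signs multiply to the sign of exchanging the two
  blocks \<open>S\<close> and \<open>U - S\<close>.\<close>

lemma wedge_rev: "wedge x y = ext_rev (wedge (ext_rev y) (ext_rev x))"
proof
  fix U
  show "wedge x y U = ext_rev (wedge (ext_rev y) (ext_rev x)) U"
  proof (cases "finite U")
    case True
    let ?e = "\<lambda>S. (- 1 :: complex) ^ (card S choose 2)"
    have sq: "?e S * ?e S = 1" for S by (simp flip: power_add mult_2)
    have "wedge x y U = (\<Sum>S\<in>Pow U. shuffle_sign (U - S) S * x (U - S) * y S)"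
      unfolding wedge_def
      by (rule sum.reindex_bij_witness[of _ "\<lambda>S. U - S" "\<lambda>S. U - S"]) (auto simp: double_diff)
    also have "\<dots> = (\<Sum>S\<in>Pow U. ?e U * (shuffle_sign S (U - S) * ext_rev y S * ext_rev x (U - S)))"
    proof (rule sum.cong[OF refl])
      fix S assume "S \<in> Pow U"
      then have S: "finite S" "finite (U - S)" "S \<subseteq> U" using True finite_subset by auto
      then have "card U = card S + card (U - S)"
        by (metis card_Diff_subset card_mono finite_Diff2 le_add_diff_inverse)
      then have "?e U * ?e S * ?e (U - S) =
          (- 1) ^ (card S * card (U - S)) * (?e S * ?e S) * (?e (U - S) * ?e (U - S))"
        by (simp add: choose_two_add power_add mult_ac)
      then have "?e U * ?e S * ?e (U - S) = (- 1) ^ (card S * card (U - S))" by (simp add: sq)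
      then have "?e U * ?e S * ?e (U - S) * shuffle_sign S (U - S) = shuffle_sign (U - S) S"
        using shuffle_sign_swap[OF S(1,2)] by simp
      then show "shuffle_sign (U - S) S * x (U - S) * y S =
          ?e U * (shuffle_sign S (U - S) * ext_rev y S * ext_rev x (U - S))"
        by (simp add: ext_rev_def mult_ac)
    qed
    finally show ?thesis by (simp add: ext_rev_def wedge_def sum_distrib_left)
  qed (simp add: ext_rev_def wedge_infinite)
qed

lemma ext_idealI:
  assumes I: "subspace class_ring I fun_space" and sub: "I \<subseteq> carrier (ext_alg n)"
    and rev: "\<And>x. x \<in> I \<Longrightarrow> ext_rev x \<in> I"
    and left: "\<And>a x. a \<in> carrier (ext_alg n) \<Longrightarrow> x \<in> I \<Longrightarrow> wedge a x \<in> I"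
  shows "ideal I (ext_alg n)"
proof -
  interpret ring "ext_alg n" by (rule ext_alg_ring)
  have "ext_rev a \<in> carrier (ext_alg n)" if "a \<in> carrier (ext_alg n)" for a
    using that by (simp add: ext_rev_def ext_alg_def)
  then have "wedge x a \<in> I" if "a \<in> carrier (ext_alg n)" "x \<in> I" for a x
    unfolding wedge_rev[of x a] using that by (intro rev left)
  then show ?thesis
    using fun_subspaceD[OF I] sub left by (intro idealI_closed) (simp_all add: ext_alg_simps)
qed

text \<open>If \<open>x\<close> starts in degree \<open>p\<close>, degree \<open>p + k\<close> of
  the product sees only components of \<open>a\<close> of degree at most \<open>k\<close>: the
  constant term for \<open>k = 0\<close>, and also the linear part for \<open>k = 1\<close>.\<close>

lemma wedge_low_left:
  assumes x: "x \<in> ext_ge n p"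
  shows "card U < p \<Longrightarrow> wedge a x U = 0"
    and "ext_proj p (wedge a x) = (\<lambda>U. a {} * ext_proj p x U)"
    and "ext_proj (Suc p) (wedge a x) =
      (\<lambda>U. a {} * ext_proj (Suc p) x U + wedge (ext_proj 1 a) (ext_proj p x) U)"
proof -
  \<comment> \<open>For \<open>p = 0\<close> the condition \<open>card U = p\<close> also holds for
    infinite \<open>U\<close>; there the coordinate vanishes by membership in the carrier.\<close>
  have inf: "x U = 0" if "infinite U" for U
    using x that ext_finite_support by (auto simp: ext_ge_def)
  have low: "x S = 0" if "card S < p" for S using x that by (simp add: ext_ge_def)
  have diff: "card (U - S) = card U - card S" "card S \<le> card U" "card S = 0 \<longleftrightarrow> S = {}"
    if "finite U" "S \<in> Pow U" for U S :: "nat set"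
    using that by (auto simp: card_Diff_subset finite_subset card_mono)
  show less: "wedge a x U = 0" if "card U < p" for U
  proof (cases "finite U")
    case True
    have "x (U - S) = 0" if "S \<in> Pow U" for S
      using diff[OF True that] \<open>card U < p\<close> by (intro low) linarith
    then show ?thesis by (simp add: wedge_def)
  qed (simp add: wedge_infinite)
  show "ext_proj p (wedge a x) = (\<lambda>U. a {} * ext_proj p x U)"
  proof
    fix U
    show "ext_proj p (wedge a x) U = a {} * ext_proj p x U"
    proof (cases "card U = p \<and> finite U")
      case True
      have "wedge a x U = (\<Sum>S\<in>Pow U. if S = {} then a {} * x U else 0)"
        unfolding wedge_def
      proof (rule sum.cong[OF refl])
        fix S assume S: "S \<in> Pow U"
        have "x (U - S) = 0" if "S \<noteq> {}" using diff[of U S] S True that by (intro low) linarith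
        then show "shuffle_sign S (U - S) * a S * x (U - S) = (if S = {} then a {} * x U else 0)"
          by auto
      qed
      then show ?thesis using True by (simp add: ext_proj_def)
    qed (auto simp: ext_proj_def wedge_infinite inf)
  qed
  show "ext_proj (Suc p) (wedge a x) =
      (\<lambda>U. a {} * ext_proj (Suc p) x U + wedge (ext_proj 1 a) (ext_proj p x) U)"
  proof
    fix U
    show "ext_proj (Suc p) (wedge a x) U =
        a {} * ext_proj (Suc p) x U + wedge (ext_proj 1 a) (ext_proj p x) U"
    proof (cases "finite U")
      case fin: True
      have t: "shuffle_sign S (U - S) * ext_proj 1 a S * ext_proj p x (U - S) =
          (if card U = Suc p \<and> card S = 1 then shuffle_sign S (U - S) * a S * x (U - S) else 0)"
        if "S \<in> Pow U" for S
        using diff[OF fin that] by (auto simp: ext_proj_def)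
      show ?thesis
      proof (cases "card U = Suc p")
        case True
        have "wedge a x U = (\<Sum>S\<in>Pow U. (if S = {} then a {} * x U else 0) +
            shuffle_sign S (U - S) * ext_proj 1 a S * ext_proj p x (U - S))"
          unfolding wedge_def
        proof (rule sum.cong[OF refl])
          fix S assume S: "S \<in> Pow U"
          \<comment> \<open>The first two cases are the constant and the linear part of
            \<open>a\<close>; in the third, \<open>U - S\<close> has fewer than \<open>p\<close>
            elements and \<open>x\<close> vanishes there.\<close>
          consider "S = {}" | "card S = 1" | "card S > 1" "S \<noteq> {}"
            using diff(3)[OF fin S] by (cases "card S"; cases "card S - 1") auto
          then show "shuffle_sign S (U - S) * a S * x (U - S) =
              (if S = {} then a {} * x U else 0) +
                shuffle_sign S (U - S) * ext_proj 1 a S * ext_proj p x (U - S)"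
          proof cases
            case 3
            then have "x (U - S) = 0" using diff(1,2)[OF fin S] True by (intro low) linarith
            then show ?thesis using 3 by (simp add: ext_proj_def)
          qed (use t[OF S] True in auto)
        qed
        then show ?thesis using True fin by (simp add: sum.distrib ext_proj_def wedge_def)
      next
        case False
        then have "wedge (ext_proj 1 a) (ext_proj p x) U = 0"
          unfolding wedge_def by (intro sum.neutral ballI) (simp only: t, simp)
        then show ?thesis using False by (simp add: ext_proj_def[of "Suc p"])
      qed
    qed (auto simp: ext_proj_def wedge_infinite inf)
  qed
qed

section \<open>The Orlik-Solomon ideal and the multiplication map\<close>

lemma wedge_deg:
  assumes "x \<in> ext_deg n p" "y \<in> ext_deg n q"
  shows "wedge x y \<in> ext_deg n (p + q)"
proof -
  have "card U = p + q" if U: "wedge x y U \<noteq> 0" for U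
  proof -
    have fin: "finite U" using U wedge_infinite by blast
    obtain S where S: "S \<subseteq> U" "x S \<noteq> 0" "y (U - S) \<noteq> 0"
      using U unfolding wedge_def
      by (metis (no_types, lifting) PowD mult_eq_0_iff sum.neutral)
    then have "card S = p" "card (U - S) = q" using assms by (auto simp: ext_deg_def)
    then show ?thesis using S(1) fin by (metis card_Diff_subset card_mono finite_subset le_add_diff_inverse)
  qed
  then show ?thesis using assms wedge_closed by (simp add: ext_deg_def)
qed

lemma bsum_tensor_pure_Cons:
  "bsum fun_space tensor_pure ((x, y) # ps) = (\<lambda>a. tensor_pure x y a + bsum fun_space tensor_pure ps a)"
  by (simp add: fun_space_def)

text \<open>A matrix \<open>F\<close> is the sum over \<open>i\<close> in \<open>I\<close> of the
  indicator of \<open>i\<close> tensored with row \<open>i\<close>; conversely, the rows of a pure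
  tensor are multiples of its second factor.\<close>

lemma tensor_supported_on:
  assumes V: "subspace class_ring V fun_space" and I: "finite I"
  shows "tensor (supported_on I) V = fun_sub (slices I V)"
proof -
  have "carrier (tensor (supported_on I) V) = slices I V"
    unfolding tensor_carrier[OF subspace_supported_on V]
  proof (intro equalityI subsetI)
    fix F assume "F \<in> {bsum fun_space tensor_pure ps | ps. set ps \<subseteq> supported_on I \<times> V}"
    then obtain ps where "F = bsum fun_space tensor_pure ps" "set ps \<subseteq> supported_on I \<times> V" by blast
    then show "F \<in> slices I V"
    proof (induction ps arbitrary: F)
      case Nil
      then show ?case using fun_subspaceD(1)[OF subspace_slices[OF V]] by (simp add: fun_space_def)
    next
      case (Cons p ps)
      obtain x y where p: "p = (x, y)" by (cases p)
      have "tensor_pure x y \<in> slices I V"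
        using Cons.prems(2) p fun_subspaceD(3)[OF V]
        by (auto simp: slices_def tensor_pure_def supported_on_def)
      moreover have "bsum fun_space tensor_pure ps \<in> slices I V" using Cons by simp
      ultimately show ?case
        unfolding Cons.prems(1) p bsum_tensor_pure_Cons by (rule fun_subspaceD(2)[OF subspace_slices[OF V]])
    qed
  next
    fix F assume F: "F \<in> slices I V"
    obtain "is" where "is": "distinct is" "set is = I" using finite_distinct_list[OF I] by blast
    let ?ps = "map (\<lambda>i. (\<lambda>a. if a = i then 1 else 0, \<lambda>b. F (i, b))) is"
    have "bsum fun_space tensor_pure ?ps (a, b) = F (a, b)" for a b
    proof -
      have "bsum fun_space tensor_pure ?ps (a, b) = (\<Sum>i\<in>I. (if a = i then 1 else 0) * F (i, b))"
        using "is" by (simp add: bsum_pure o_def sum_list_distinct_conv_sum_set del: mult_eq_0_iff)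
      also have "\<dots> = (\<Sum>i\<in>I. if i = a then F (a, b) else 0)" by (rule sum.cong) auto
      also have "\<dots> = F (a, b)" using I F by (simp add: slices_def)
      finally show ?thesis .
    qed
    then have "F = bsum fun_space tensor_pure ?ps" by auto
    moreover have "set ?ps \<subseteq> supported_on I \<times> V"
      using F "is" by (auto simp: slices_def supported_on_def split: if_splits)
    ultimately show "F \<in> {bsum fun_space tensor_pure ps | ps. set ps \<subseteq> supported_on I \<times> V}" by blast
  qed
  then show ?thesis by (simp add: tensor_def)
qed

section \<open>The multiplication map on tensors\<close>

lemma tensor_simps:
  "add (tensor U V) = (\<lambda>F G p. F p + G p)" "smult (tensor U V) = (\<lambda>c F p. c * F p)"
  by (simp_all add: tensor_def fun_space_def)

lemma mult_map_linear:
  "mult_map (\<lambda>p. F p + G p) = (\<lambda>U. mult_map F U + mult_map G U)"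
  "mult_map (\<lambda>p. c * F p) = (\<lambda>U. c * mult_map F U)"
  "mult_map (\<lambda>p. 0) = (\<lambda>U. 0)"
  by (simp_all add: mult_map_def sum.distrib sum_distrib_left algebra_simps)

lemma mult_map_tensor:
  assumes W: "subspace class_ring W fun_space"
    and U: "subspace class_ring U fun_space" and V: "subspace class_ring V fun_space"
    and wedge: "\<And>x y. x \<in> U \<Longrightarrow> y \<in> V \<Longrightarrow> wedge x y \<in> W"
    and F: "F \<in> carrier (tensor U V)"
  shows "mult_map F \<in> W"
proof -
  obtain ps where "F = bsum fun_space tensor_pure ps" "set ps \<subseteq> U \<times> V"
    using F unfolding tensor_carrier[OF U V] by blast
  then show ?thesis
  proof (induction ps arbitrary: F)
    case Nil
    then show ?case using fun_subspaceD(1)[OF W] by (simp add: fun_space_def mult_map_linear)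
  next
    case (Cons p ps)
    obtain x y where p: "p = (x, y)" by (cases p)
    have "wedge x y \<in> W" "mult_map (bsum fun_space tensor_pure ps) \<in> W"
      using Cons p wedge by auto
    then show ?case
      unfolding Cons.prems(1) p bsum_tensor_pure_Cons mult_map_linear mult_map_pure
      by (rule fun_subspaceD(2)[OF W])
  qed
qed

lemma pure_in_tensor:
  assumes "subspace class_ring U fun_space" "subspace class_ring V fun_space" "x \<in> U" "y \<in> V"
  shows "tensor_pure x y \<in> carrier (tensor U V)"
  unfolding tensor_carrier[OF assms(1,2)]
  using assms(3,4) by (intro CollectI exI[of _ "[(x, y)]"]) (simp add: fun_space_def)

lemma subspace_ideal_deg: "ideal I (ext_alg n) \<Longrightarrow> subspace class_ring (I \<inter> ext_deg n p) fun_space"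
  using fun_subspaceD[OF ideal_subspace] fun_subspaceD[OF subspace_ext_deg]
  by (intro fun_subspaceI) auto

text \<open>Holds for unsorted tuples too: reordering changes only the sign, and a repeated entry
  makes the monomial zero.\<close>

lemma ext_monom_support: "ext_monom is S \<noteq> 0 \<Longrightarrow> S = set is"
proof (induction "is" arbitrary: S)
  case (Cons i "is")
  then show ?case by (auto simp: ext_monom_Cons wedge_ext_gen split: if_splits)
qed (simp add: ext_monom_def split: if_splits)

lemma ext_ge_ideal: "ideal (ext_ge n p) (ext_alg n)"
proof (rule ext_idealI)
  interpret vectorspace class_ring "ext_alg n" by (rule ext_alg_vectorspace)
  show "subspace class_ring (ext_ge n p) fun_space"
    using a_closed smult_closed zero_closed
    by (intro fun_subspaceI) (simp_all add: ext_ge_def ext_alg_simps)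
  show "wedge a x \<in> ext_ge n p" if "a \<in> carrier (ext_alg n)" "x \<in> ext_ge n p" for a x
    using that wedge_low_left(1)[OF that(2)] wedge_closed[of a n x] by (simp add: ext_ge_def)
qed (auto simp: ext_ge_def ext_rev_def ext_alg_def)

lemma ext_bdry_carrier: "ext_bdry n x \<in> carrier (ext_alg n)"
  using ext_bdry_outside by (auto simp: ext_alg_def)

lemma os_ideal_ideal: "ideal (os_ideal n indep) (ext_alg n)"
  unfolding os_ideal_def using ext_bdry_carrier by (intro ring.genideal_ideal[OF ext_alg_ring]) blast

lemma os_ideal2_ideal: "ideal (os_ideal2 n indep) (ext_alg n)"
proof -
  interpret ring "ext_alg n" by (rule ext_alg_ring)
  have "os_ideal_deg n indep p \<subseteq> carrier (ext_alg n)" for p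
    by (auto simp: os_ideal_deg_def ext_deg_def)
  then show ?thesis
    unfolding os_ideal2_def by (intro genideal_ideal set_add_closed)
qed

section \<open>Low degrees of the ideals of a simple matroid\<close>

context
  fixes n :: nat and indep :: "nat set \<Rightarrow> bool"
  assumes simple: "simple_matroid {1..n} indep"
begin

interpretation simple_matroid "{1..n}" indep by (rule simple)

text \<open>Simplicity enters here: the empty set, points and pairs are all independent.\<close>

lemma dependent_card: "S \<subseteq> {1..n} \<Longrightarrow> \<not> indep S \<Longrightarrow> 3 \<le> card S"
proof (rule ccontr)
  assume S: "S \<subseteq> {1..n}" "\<not> indep S" "\<not> 3 \<le> card S"
  have "finite S" using S(1) finite_subset by blast
  moreover have "card S = 0 \<or> card S = 1 \<or> card S = 2" using S(3) by auto
  ultimately show False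
    using S(1,2) indep_empty no_loop no_parallel by (auto simp: card_1_singleton_iff card_2_iff)
qed

text \<open>The generators come from dependent sets of size at least 3 and the boundary lowers the
  degree by one. Since \<open>ext_ge n 2\<close> is an ideal, it contains what they
  generate.\<close>

lemma os_ideal_ge: "os_ideal n indep \<subseteq> ext_ge n 2"
  unfolding os_ideal_def
proof (rule ring.genideal_minimal[OF ext_alg_ring ext_ge_ideal], safe)
  fix "is" assume "is": "set is \<subseteq> {1..n}" "\<not> indep (set is)"
  have "2 \<le> card U" if U: "ext_bdry n (ext_monom is) U \<noteq> 0" for U
  proof -
    have "U \<subseteq> {1..n}" using U ext_bdry_outside by blast
    \<comment> \<open>A coordinate of the boundary at \<open>U\<close> collects coordinates of the
      monomial at sets \<open>insert i U\<close>, so \<open>U\<close> misses at most one entry of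
      the tuple.\<close>
    then obtain i where "ext_monom is (insert i U) \<noteq> 0"
      using U by (force simp: ext_bdry_coord intro: sum.neutral)
    then have "set is = insert i U" using ext_monom_support by blast
    then show ?thesis
      using dependent_card[OF "is"] card_insert_le_m1[of 3 U i] card_insert_if[of U i]
        \<open>U \<subseteq> {1..n}\<close> finite_subset[of U "{1..n}"]
      by (auto split: if_splits)
  qed
  then show "ext_bdry n (ext_monom is) \<in> ext_ge n 2"
    using ext_bdry_carrier by (force simp: ext_ge_def)
qed

lemma os_ideal_deg_1: "os_ideal_deg n indep 1 = {\<lambda>S. 0}"
proof -
  have "x S = 0" if "x \<in> os_ideal_deg n indep 1" for x S
  proof (rule ccontr)
    assume "x S \<noteq> 0"
    moreover have "x \<in> ext_ge n 2" "x \<in> ext_deg n 1"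
      using that os_ideal_ge by (auto simp: os_ideal_deg_def)
    ultimately have "card S = 1" "\<not> card S < 2" by (auto simp: ext_deg_def ext_ge_def)
    then show False by simp
  qed
  then show ?thesis
    using fun_subspaceD(1)[OF ideal_subspace[OF os_ideal_ideal]] fun_subspaceD(1)[OF subspace_ext_deg]
    by (auto simp: os_ideal_deg_def)
qed

lemma os_ideal_deg_2_le: "os_ideal_deg n indep 2 \<subseteq> os_ideal2 n indep"
proof -
  interpret ring "ext_alg n" by (rule ext_alg_ring)
  have sub: "os_ideal_deg n indep p \<subseteq> carrier (ext_alg n)" for p
    by (auto simp: os_ideal_deg_def ext_deg_def)
  have "os_ideal_deg n indep 2 \<subseteq> os_ideal_deg n indep 1 <+>\<^bsub>ext_alg n\<^esub> os_ideal_deg n indep 2"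
    unfolding os_ideal_deg_1 by (simp add: set_add_def' ext_alg_simps)
  then show ?thesis
    unfolding os_ideal2_def using genideal_self[OF set_add_closed[OF sub sub]] by blast
qed

text \<open>The outer bound on the generated ideal. \<open>W\<close> is left open so that the image
  of the multiplication map can be inserted.\<close>

lemma os_ideal2_deg_3_le:
  assumes W: "subspace class_ring W fun_space"
    and prod: "\<And>x y. x \<in> ext_deg n 1 \<Longrightarrow> y \<in> os_ideal_deg n indep 2 \<Longrightarrow> wedge x y \<in> W"
  shows "os_ideal2 n indep \<inter> ext_deg n 3 \<subseteq> W"
proof -
  interpret ring "ext_alg n" by (rule ext_alg_ring)
  let ?I2 = "os_ideal_deg n indep 2"
  have I2: "subspace class_ring ?I2 fun_space"
    unfolding os_ideal_deg_def by (rule subspace_ideal_deg[OF os_ideal_ideal])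
  \<comment> \<open>No condition above degree three is needed: \<open>J\<close> is an ideal because it starts in degree two.\<close>
  define J where "J = {x \<in> ext_ge n 2. ext_proj 2 x \<in> ?I2 \<and> ext_proj 3 x \<in> W}"
  have "ideal J (ext_alg n)"
  proof (rule ext_idealI)
    have add: "ext_proj p (\<lambda>S. x S + y S) = (\<lambda>S. ext_proj p x S + ext_proj p y S)" for p x y
      by (auto simp: ext_proj_def)
    have scale: "ext_proj p (\<lambda>S. c * x S) = (\<lambda>S. c * ext_proj p x S)" for p c x
      by (auto simp: ext_proj_def)
    \<comment> \<open>In each group of three: zero, sums, multiples. Facts 1 to 3 concern
      \<open>?I2\<close>, 4 to 6 \<open>W\<close>, 7 to 9 the ideals \<open>ext_ge\<close>.\<close>
    note sub = fun_subspaceD[OF I2] fun_subspaceD[OF W] fun_subspaceD[OF ideal_subspace[OF ext_ge_ideal]]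
    show "subspace class_ring J fun_space"
      by (rule fun_subspaceI) (auto simp: J_def add scale sub, auto simp: ext_proj_def sub)
    show "J \<subseteq> carrier (ext_alg n)" by (auto simp: J_def ext_ge_def)
    fix x assume x: "x \<in> J"
    then have x2: "x \<in> ext_ge n 2" "ext_proj 2 x \<in> ?I2" "ext_proj 3 x \<in> W" by (auto simp: J_def)
    \<comment> \<open>On a fixed degree the reversal is a constant sign, so it preserves conditions
      that place components in subspaces.\<close>
    have "ext_proj p (ext_rev x) = (\<lambda>S. (- 1) ^ (p choose 2) * ext_proj p x S)" for p
      by (auto simp: ext_proj_def ext_rev_def)
    moreover have "ext_rev x \<in> ext_ge n 2"
      using x2(1) by (auto simp: ext_ge_def ext_rev_def ext_alg_def)
    ultimately show "ext_rev x \<in> J" using x2(2,3) by (simp only: J_def sub mem_Collect_eq simp_thms)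
    fix a assume a: "a \<in> carrier (ext_alg n)"
    \<comment> \<open>The one contribution to degree three that is not a multiple of
      \<open>ext_proj 3 x\<close>; the assumption on \<open>W\<close> is made for it.\<close>
    have "wedge (ext_proj 1 a) (ext_proj 2 x) \<in> W" by (rule prod[OF ext_proj_deg[OF a] x2(2)])
    moreover have "ext_proj 3 (wedge a x) =
        (\<lambda>U. a {} * ext_proj 3 x U + wedge (ext_proj 1 a) (ext_proj 2 x) U)"
      using wedge_low_left(3)[OF x2(1), of a] by (simp del: One_nat_def)
    ultimately have "ext_proj 2 (wedge a x) \<in> ?I2" "ext_proj 3 (wedge a x) \<in> W"
      using wedge_low_left(2)[OF x2(1), of a] sub(3)[OF x2(2), of "a {}"]
        sub(5)[OF sub(6)[OF x2(3), of "a {}"]] by simp_all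
    moreover have "wedge a x \<in> ext_ge n 2"
      using ideal.I_l_closed[OF ext_ge_ideal x2(1) a] by (simp add: ext_alg_simps)
    ultimately show "wedge a x \<in> J" by (simp add: J_def)
  qed
  moreover have "?I2 \<subseteq> J"
  proof
    fix x assume x: "x \<in> ?I2"
    then have "ext_proj 2 x = x" "ext_proj 3 x = (\<lambda>S. 0)" "x \<in> ext_ge n 2"
      by (auto simp: os_ideal_deg_def ext_deg_def ext_proj_def ext_ge_def fun_eq_iff)
    then show "x \<in> J" using x fun_subspaceD(1)[OF W] by (simp add: J_def)
  qed
  ultimately have "os_ideal2 n indep \<subseteq> J"
    unfolding os_ideal2_def os_ideal_deg_1
    by (intro genideal_minimal) (auto simp: set_add_def' ext_alg_simps)
  moreover have "ext_proj 3 x = x" if "x \<in> ext_deg n 3" for x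
    using that by (auto simp: ext_deg_def ext_proj_def fun_eq_iff)
  ultimately show ?thesis by (force simp: J_def)
qed

text \<open>Rank-nullity for the multiplication map. Its image lies in the degree-three part of
  \<open>os_ideal2\<close>; being a subspace that contains all products, it also exhausts that part
  by \<open>os_ideal2_deg_3_le\<close>.\<close>

lemma nullity_mult_map:
  "cdim (fun_sub (os_ideal2 n indep \<inter> ext_deg n 3)) +
    nullity (tensor (ext_deg n 1) (os_ideal_deg n indep 2)) ((ext_alg n)\<lparr>carrier := ext_deg n 3\<rparr>) mult_map =
    n * cdim (fun_sub (os_ideal_deg n indep 2))"
proof -
  let ?I2 = "os_ideal_deg n indep 2" and ?S = "{S. S \<subseteq> {1..n} \<and> card S = 1}"
    and ?W = "os_ideal2 n indep \<inter> ext_deg n 3" and ?E3 = "(ext_alg n)\<lparr>carrier := ext_deg n 3\<rparr>"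
  let ?T = "tensor (ext_deg n 1) ?I2"
  have I2: "subspace class_ring ?I2 fun_space"
    unfolding os_ideal_deg_def by (rule subspace_ideal_deg[OF os_ideal_ideal])
  have W: "subspace class_ring ?W fun_space" by (rule subspace_ideal_deg[OF os_ideal2_ideal])
  have card_S: "card ?S = n" using n_subsets[of "{1..n}" 1] by simp
  have I2_supp: "?I2 \<subseteq> supported_on {S. S \<subseteq> {1..n} \<and> card S = 2}"
    unfolding os_ideal_deg_def ext_deg_eq by blast
  have T: "?T = fun_sub (slices ?S ?I2)"
    unfolding ext_deg_eq by (rule tensor_supported_on[OF I2 finite_subsets_card])
  have "wedge x y \<in> ?W" if "x \<in> ext_deg n 1" "y \<in> ?I2" for x y
    using that wedge_deg[of x n 1 y 2] os_ideal_deg_2_le ideal.I_l_closed[OF os_ideal2_ideal, of y n indep x]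
    by (auto simp: os_ideal_deg_def ext_deg_def ext_alg_simps)
  then have im_le: "mult_map F \<in> ?W" if "F \<in> carrier ?T" for F
    using mult_map_tensor[OF W subspace_ext_deg I2 _ that] by blast
  interpret V: vectorspace class_ring ?T
    unfolding T by (rule fun_sub_vectorspace[OF subspace_slices[OF I2]])
  \<comment> \<open>Supplies the vector space structure on the codomain \<open>?E3\<close> that the
    interpretation of \<open>mult_map\<close> requires.\<close>
  interpret E: linear_map class_ring "fun_sub (ext_deg n 3)" ?E3 "\<lambda>x. x"
    by (rule fun_sub_ext_alg[OF subspace_ext_deg])
  interpret f: linear_map class_ring ?T ?E3 mult_map
  proof
    show "mult_map \<in> LinearCombinations.module_hom class_ring ?T ?E3"
      using im_le unfolding LinearCombinations.module_hom_def
      by (auto simp: tensor_simps ext_alg_simps mult_map_linear)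
  qed
  have im: "f.im = ?W"
  proof
    show "f.im \<subseteq> ?W" unfolding f.im_def using im_le by blast
    interpret im: submodule class_ring f.im ?E3 by (rule f.im_is_submodule)
    \<comment> \<open>The image is known as a submodule of \<open>?E3\<close>; the outer bound asks
      for a subspace of all functions, with the same operations.\<close>
    have "subspace class_ring f.im fun_space"
      using im.zero_closed im.m_closed im.smult_closed
      by (intro fun_subspaceI) (auto simp: ext_alg_simps)
    moreover have "wedge x y \<in> f.im" if "x \<in> ext_deg n 1" "y \<in> ?I2" for x y
      unfolding f.im_def mult_map_pure[symmetric]
      by (intro imageI pure_in_tensor[OF subspace_ext_deg I2] that)
    ultimately show "?W \<subseteq> f.im" by (rule os_ideal2_deg_3_le)
  qed
  have "V.fin_dim"
    unfolding T
  proof (rule subspace_fun_sub_fin_dim[OF subspace_slices[OF I2]])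
    show "slices ?S ?I2 \<subseteq> supported_on (?S \<times> {S. S \<subseteq> {1..n} \<and> card S = 2})"
      by (rule slices_supported_on[OF I2_supp])
  qed (intro finite_cartesian_product finite_subsets_card)
  from f.rank_nullity[OF this] have "cdim (fun_sub ?W) + nullity ?T ?E3 mult_map = V.dim"
    unfolding im nullity_def using cdim_ext_sub[OF W Int_lower2] by simp
  also have "\<dots> = n * cdim (fun_sub ?I2)"
    unfolding T cdim_slices[OF I2 I2_supp finite_subsets_card finite_subsets_card] card_S by (rule refl)
  finally show ?thesis .
qed

end

text \<open>Count pairs of a point and a 2-subset: \<open>2 * (n choose 2)\<close> have the point
  inside, \<open>3 * (n choose 3)\<close> outside. Pascal's rule merges two copies of each binomial
  into \<open>2 * (Suc n choose 3)\<close>.\<close>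

lemma two_choose_Suc_three: "n * (n choose 2) = (n choose 3) + 2 * (Suc n choose 3)"
proof (induction n)
  case (Suc n)
  have "n * n = 2 * (n choose 2) + n"
    by (induction n) (simp_all add: numeral_2_eq_2)
  then show ?case using Suc by (simp add: eval_nat_numeral algebra_simps)
qed simp

theorem theorem4p7:
  fixes n :: nat and indep :: "nat set \<Rightarrow> bool" and w2 phi3 :: nat
  assumes "simple_matroid {1..n} indep"
    and "w2 = cdim (os_alg_deg n indep 2)"
    and "phi3 = nullity (tensor (ext_deg n 1) (os_ideal_deg n indep 2))
                  ((ext_alg n)\<lparr>carrier := ext_deg n 3\<rparr>) mult_map"
  shows "int phi3 = 2 * int ((n + 1) choose 3) - int n * int w2 + int (cdim (os_alg2_deg n indep 3))"
proof -
  let ?d2 = "cdim (fun_sub (os_ideal_deg n indep 2))"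
    and ?d3 = "cdim (fun_sub (os_ideal2 n indep \<inter> ext_deg n 3))"
  have "w2 + ?d2 = n choose 2"
    using cdim_quot_alg[OF os_ideal_ideal]
    by (simp add: assms(2) os_alg_deg_def os_alg_def os_ideal_deg_def)
  moreover have A2: "cdim (os_alg2_deg n indep 3) + ?d3 = n choose 3"
    using cdim_quot_alg[OF os_ideal2_ideal] by (simp add: os_alg2_deg_def os_alg2_def)
  moreover have "?d3 + phi3 = n * ?d2"
    using nullity_mult_map[OF assms(1)] by (simp add: assms(3))
  \<comment> \<open>Both sides equal \<open>n * (n choose 2)\<close>. Since \<open>n * ?d2\<close>
    is \<open>?d3 + phi3\<close>, the term \<open>?d3\<close> cancels in the natural numbers, and
    subtraction appears only after passing to integers.\<close>
  ultimately have "n * (w2 + ?d2) = cdim (os_alg2_deg n indep 3) + ?d3 + 2 * (Suc n choose 3)"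
    "?d3 + phi3 = n * ?d2"
    by (simp_all only: two_choose_Suc_three)
  then have "phi3 + n * w2 = cdim (os_alg2_deg n indep 3) + 2 * (Suc n choose 3)"
    by (simp add: distrib_left)
  then have "int phi3 + int n * int w2 = int (cdim (os_alg2_deg n indep 3)) + 2 * int (Suc n choose 3)"
    by (metis of_nat_add of_nat_mult of_nat_numeral)
  then show ?thesis by simp
qed

end
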